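(* Let $n \ge 6$ and $1 \le k \le n$ be integers, and let $S$ be a primitive non-powerful signed digraph of order $n$. Then: (1) $L(S,k) \le (2n-k)(n-1)+1$. (2) $L(S,k) = (2n-k)(n-1)+1$ if and only if the underlying digraph of $S$ is isomorphic to $D_1$. (3) $L(S,k) = (2n-k)(n-1)$ if and only if the underlying digraph of $S$ is isomorphic to $D_2$ and the two cycles of length $n-1$ in $S$ have the same sign. (4) For each integer $t$ with $(2n-k)(n-1)-3 < t < (2n-k)(n-1)$, there is no primitive non-powerful signed digraph $S$ of order $n$ with $L(S,k)=t$.
   Context: A signed digraph $S$ is a digraph (loops allowed, no multiple arcs) on a finite vertex set in which each arc is assigned a sign $1$ or $-1$; its underlying digraph is obtained by forgetting the signs, and its order is its number of vertices. A walk of length $m$ is a sequence of arcs $e_1,\dots,e_m$ such that the terminal vertex of $e_i$ is the initial vertex of $e_{i+1}$; for each vertex $u$ there is also the trivial walk of length $0$ from $u$ to $u$. The sign of a walk is the product of the signs of its arcs (the trivial walk has sign $1$). Two walks form a pair of SSSD walks if they have the same initial vertex, the same terminal vertex, the same length, but different signs. A digraph $D$ is primitive if there is a positive integer $m$ such that for every ordered pair $(u,v)$ of vertices there is a walk of length $m$ from $u$ to $v$; a signed digraph is primitive if its underlying digraph is. A signed digraph is non-powerful if it contains a pair of SSSD walks (equivalently, some power of its sign pattern matrix, computed with $1+(-1)=\#$ ambiguous, has an entry $\#$). For a primitive non-powerful signed digraph $S$ and $X \subseteq V(S)$, $l_S(X)$ is the least integer $p\ge 0$ such that for every vertex $v$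 of $S$ there exist $x\in X$ and a pair of SSSD walks of length $p$ from $x$ to $v$; the $k$th upper base is $L(S,k)=\max\{l_S(X) : X\subseteq V(S),\ |X|=k\}$. $D_1$ is the digraph with vertex set $\{1,\dots,n\}$ and arcs $(i,i+1)$ for $1\le i\le n-1$, $(n,1)$ and $(n-1,1)$. $D_2$ is the digraph obtained from $D_1$ by adding the arc $(n,2)$; it has exactly two cycles of length $n-1$ (namely $1\to2\to\cdots\to n-1\to1$ and $2\to3\to\cdots\to n\to2$). *)

theory Defs
  imports "Graph_Theory.Graph_Theory"
begin

text \<open>
  Arcs are pairs of vertices, which rules out multiple arcs but permits loops. The sign function
  is total; only its values on the arcs of the underlying digraph are meaningful.
\<close>

record 'a pre_signed_digraph =
  underlying :: "'a pair_pre_digraph"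
  arc_sign :: "'a \<times> 'a \<Rightarrow> int"

locale signed_digraph = pair_fin_digraph "underlying S"
  for S :: "'a pre_signed_digraph" +
  assumes arc_sign_values: "\<And>e. e \<in> parcs (underlying S) \<Longrightarrow> arc_sign S e \<in> {1, -1}"

definition order :: "'a pre_signed_digraph \<Rightarrow> nat" where
  "order S = card (pverts (underlying S))"

definition walk_sign :: "'a pre_signed_digraph \<Rightarrow> ('a \<times> 'a) list \<Rightarrow> int" where
  "walk_sign S p = prod_list (map (arc_sign S) p)"

definition SSSD_pair ::
  "'a pre_signed_digraph \<Rightarrow> 'a \<Rightarrow> 'a \<Rightarrow> nat \<Rightarrow> ('a \<times> 'a) list \<Rightarrow> ('a \<times> 'a) list \<Rightarrow> bool" where
  "SSSD_pair S u v m p q \<longleftrightarrow>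
     pre_digraph.awalk (with_proj (underlying S)) u p v \<and>
     pre_digraph.awalk (with_proj (underlying S)) u q v \<and>
     length p = m \<and> length q = m \<and> walk_sign S p \<noteq> walk_sign S q"

definition primitive :: "'a pair_pre_digraph \<Rightarrow> bool" where
  "primitive D \<longleftrightarrow>
     (\<exists>m>0. \<forall>u\<in>pverts D. \<forall>v\<in>pverts D.
        \<exists>p. pre_digraph.awalk (with_proj D) u p v \<and> length p = m)"

definition nonpowerful :: "'a pre_signed_digraph \<Rightarrow> bool" where
  "nonpowerful S \<longleftrightarrow> (\<exists>u v m p q. SSSD_pair S u v m p q)"

definition primitive_nonpowerful :: "'a pre_signed_digraph \<Rightarrow> bool" where
  "primitive_nonpowerful S \<longleftrightarrow>
     signed_digraph S \<and> primitive (underlying S) \<and> nonpowerful S"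

text \<open>
  For a primitive non-powerful signed digraph and a nonempty vertex set the least value below
  exists, and for k between 1 and the order the maximum is over a finite nonempty set. Outside
  of this range the two functions are not meaningful.
\<close>

definition base_set :: "'a pre_signed_digraph \<Rightarrow> 'a set \<Rightarrow> nat" where
  "base_set S X =
     (LEAST p. \<forall>v\<in>pverts (underlying S). \<exists>x\<in>X. \<exists>w w'. SSSD_pair S x v p w w')"

definition upper_base :: "'a pre_signed_digraph \<Rightarrow> nat \<Rightarrow> nat" where
  "upper_base S k = Max {base_set S X | X. X \<subseteq> pverts (underlying S) \<and> card X = k}"

definition D1 :: "nat \<Rightarrow> nat pair_pre_digraph" where
  "D1 n = \<lparr> pverts = {1..n},
            parcs = {(i, i + 1) | i. 1 \<le> i \<and> i \<le> n - 1} \<union> {(n, 1), (n - 1, 1)} \<rparr>"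

definition D2 :: "nat \<Rightarrow> nat pair_pre_digraph" where
  "D2 n = \<lparr> pverts = pverts (D1 n), parcs = insert (n, 2) (parcs (D1 n)) \<rparr>"

text \<open>
  A cycle is represented by the list of its arcs from some starting vertex, so every cycle of
  length m occurs as m lists, all with the same sign. If the digraph has exactly two cycles of
  length m, as \<open>D2 n\<close> has for m = n - 1, the following says that these two have the same sign.
\<close>

definition cycles_same_sign :: "'a pre_signed_digraph \<Rightarrow> nat \<Rightarrow> bool" where
  "cycles_same_sign S m \<longleftrightarrow>
     (\<forall>c c'. pre_digraph.cycle (with_proj (underlying S)) c \<and> length c = m \<and>
             pre_digraph.cycle (with_proj (underlying S)) c' \<and> length c' = m \<longrightarrow>
             walk_sign S c = walk_sign S c')"

end

theory Submission
  imports Defs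
begin

text \<open>
  Let \<open>A(t,v)\<close> be the set of vertices with an SSSD pair of length \<open>t\<close> to \<open>v\<close>. If \<open>w\<close> lies on a
  closed walk of length \<open>s\<close>, then \<open>A(t,w)\<close>, \<open>A(t+s,w)\<close>, \<open>A(t+2s,w)\<close>, ... is an increasing chain that
  grows strictly until it is everything, because the \<open>s\<close>-th power of a primitive digraph is strongly
  connected; and \<open>A(sn,w)\<close> is nonempty, since otherwise all signs could be gauged away. A shortest
  cycle, of length \<open>s\<close>, reaches every vertex in exactly \<open>n - s\<close> steps, so
  \<open>L(S,k) \<le> s n + s (n - k) + n - s\<close>. For \<open>s \<le> n - 2\<close> this is below \<open>(2n-k)(n-1) - 3\<close>, and \<open>s = n\<close>
  contradicts primitivity. If \<open>s = n - 1\<close>, minimality of the cycle leaves only \<open>D\<^sub>1\<close> and \<open>D\<^sub>2\<close> for the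
  way in which the remaining vertex is attached. In \<open>D\<^sub>2\<close> every vertex lies on an \<open>(n-1)\<close>-cycle, which
  saves one step, and two \<open>(n-1)\<close>-cycles of different sign give short SSSD pairs at a common
  vertex. Conversely, in \<open>D\<^sub>1\<close>, and in \<open>D\<^sub>2\<close> with \<open>(n-1)\<close>-cycles of equal sign, length and sign of a
  walk with given ends depend only on how often it closes up cycles of length \<open>n\<close> and \<open>n - 1\<close>, so
  an SSSD pair is at least \<open>n(n-1)\<close> longer than some representation by \<open>n\<close> and \<open>n - 1\<close>.
\<close>

section \<open>Signed walks\<close>

definition signed_walk :: "'a pre_signed_digraph \<Rightarrow> 'a \<Rightarrow> nat \<Rightarrow> int \<Rightarrow> 'a \<Rightarrow> bool" where
  "signed_walk S u t \<sigma> v \<longleftrightarrow>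
     (\<exists>p. pre_digraph.awalk (with_proj (underlying S)) u p v \<and> length p = t \<and> walk_sign S p = \<sigma>)"

text \<open>This is the set \<open>A(t,v)\<close> of the overview. Since walk signs are 1 or -1,
  asking for both signs amounts to asking for an SSSD pair.\<close>

definition ambiguous :: "'a pre_signed_digraph \<Rightarrow> nat \<Rightarrow> 'a \<Rightarrow> 'a set" where
  "ambiguous S t v = {u. signed_walk S u t 1 v \<and> signed_walk S u t (-1) v}"

context signed_digraph
begin

abbreviation "V \<equiv> pverts (underlying S)"
abbreviation "E \<equiv> parcs (underlying S)"
abbreviation "sw \<equiv> signed_walk S"
abbreviation "amb \<equiv> ambiguous S"
abbreviation joined :: "'a \<Rightarrow> nat \<Rightarrow> 'a \<Rightarrow> bool" where
  "joined u t v \<equiv> \<exists>\<sigma>. sw u t \<sigma> v"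

lemma walk_sign_Nil [simp]: "walk_sign S [] = 1"
  and walk_sign_Cons [simp]: "walk_sign S (e # p) = arc_sign S e * walk_sign S p"
  and walk_sign_append: "walk_sign S (p @ q) = walk_sign S p * walk_sign S q"
  by (simp_all add: walk_sign_def)

lemma sw_0 [simp]: "sw u 0 \<sigma> v \<longleftrightarrow> u = v \<and> u \<in> V \<and> \<sigma> = 1"
  by (auto simp: signed_walk_def awalk_Nil_iff)

lemma sw_append:
  assumes "sw u s \<sigma> v" "sw v t \<tau> w"
  shows "sw u (s + t) (\<sigma> * \<tau>) w"
proof -
  from assms obtain p q where "awalk u p v" "length p = s" "walk_sign S p = \<sigma>"
    "awalk v q w" "length q = t" "walk_sign S q = \<tau>"
    unfolding signed_walk_def by blast
  then have "awalk u (p @ q) w \<and> length (p @ q) = s + t \<and> walk_sign S (p @ q) = \<sigma> * \<tau>"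
    using awalk_appendI[of u p v q w] by (simp add: walk_sign_append)
  then show ?thesis
    unfolding signed_walk_def by blast
qed

lemma sw_splitE:
  assumes "sw u (s + t) \<sigma> w"
  obtains v \<sigma>1 \<sigma>2 where "sw u s \<sigma>1 v" "sw v t \<sigma>2 w" "\<sigma> = \<sigma>1 * \<sigma>2"
proof -
  from assms obtain p where p: "awalk u p w" "length p = s + t" "walk_sign S p = \<sigma>"
    unfolding signed_walk_def by blast
  let ?a = "take s p" and ?b = "drop s p" and ?v = "last (pawalk_verts u (take s p))"
  have "awalk u (?a @ ?b) w"
    using p(1) by simp
  then have "awalk u ?a ?v" "awalk ?v ?b w"
    unfolding awalk_append_iff by auto
  moreover have "\<sigma> = walk_sign S ?a * walk_sign S ?b"
    using p(3) walk_sign_append[of ?a ?b] by simp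
  moreover have "length ?a = s" "length ?b = t"
    using p(2) by auto
  ultimately show thesis
    by (intro that[of "walk_sign S ?a" ?v "walk_sign S ?b"]) (auto simp: signed_walk_def)
qed

lemma sw_1: "sw u 1 \<sigma> v \<longleftrightarrow> (u, v) \<in> E \<and> \<sigma> = arc_sign S (u, v)"
proof
  assume "sw u 1 \<sigma> v"
  then obtain e where "awalk u [e] v" "\<sigma> = arc_sign S e"
    by (auto simp: signed_walk_def length_Suc_conv)
  then show "(u, v) \<in> E \<and> \<sigma> = arc_sign S (u, v)"
    by (cases e) (auto simp: awalk_simps)
next
  assume "(u, v) \<in> E \<and> \<sigma> = arc_sign S (u, v)"
  then have "awalk u [(u, v)] v \<and> length [(u, v)] = 1 \<and> walk_sign S [(u, v)] = \<sigma>"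
    by (auto simp: awalk_simps wellformed')
  then show "sw u 1 \<sigma> v"
    unfolding signed_walk_def by blast
qed

lemma arc_sign_cases: "e \<in> E \<Longrightarrow> arc_sign S e = 1 \<or> arc_sign S e = -1"
  using arc_sign_values by auto

lemma sw_sign: "sw u t \<sigma> v \<Longrightarrow> \<sigma> = 1 \<or> \<sigma> = -1"
proof -
  have "walk_sign S p = 1 \<or> walk_sign S p = -1" if "set p \<subseteq> E" for p
    using that by (induction p) (auto dest: arc_sign_cases)
  then show "sw u t \<sigma> v \<Longrightarrow> \<sigma> = 1 \<or> \<sigma> = -1"
    by (auto simp: signed_walk_def)
qed

lemma sw_sign_square: "sw u t \<sigma> v \<Longrightarrow> \<sigma> * \<sigma> = 1"
  by (auto dest: sw_sign)

lemma sw_verts: "sw u t \<sigma> v \<Longrightarrow> u \<in> V" "sw u t \<sigma> v \<Longrightarrow> v \<in> V"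
  by (auto simp: signed_walk_def)

lemma amb_subset: "amb t v \<subseteq> V"
  by (auto simp: ambiguous_def dest: sw_verts)

lemma amb_iff_differing:
  "u \<in> amb t v \<longleftrightarrow> (\<exists>\<sigma> \<tau>. sw u t \<sigma> v \<and> sw u t \<tau> v \<and> \<sigma> \<noteq> \<tau>)"
proof
  assume "u \<in> amb t v"
  then show "\<exists>\<sigma> \<tau>. sw u t \<sigma> v \<and> sw u t \<tau> v \<and> \<sigma> \<noteq> \<tau>"
    unfolding ambiguous_def by (intro exI[of _ 1] exI[of _ "-1"]) auto
next
  assume "\<exists>\<sigma> \<tau>. sw u t \<sigma> v \<and> sw u t \<tau> v \<and> \<sigma> \<noteq> \<tau>"
  then obtain \<sigma> \<tau> where "sw u t \<sigma> v" "sw u t \<tau> v" "\<sigma> \<noteq> \<tau>"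
    by blast
  moreover from this have "\<sigma> = 1 \<and> \<tau> = -1 \<or> \<sigma> = -1 \<and> \<tau> = 1"
    using sw_sign by metis
  ultimately show "u \<in> amb t v"
    by (auto simp: ambiguous_def)
qed

lemma amb_iff_SSSD: "u \<in> amb t v \<longleftrightarrow> (\<exists>p q. SSSD_pair S u v t p q)"
  unfolding amb_iff_differing SSSD_pair_def signed_walk_def by blast

text \<open>Signs are invertible, so two different signs stay different after a common continuation;
  \<open>amb_prepend\<close> is the mirror image.\<close>

lemma amb_append:
  assumes "u \<in> amb s v" "joined v t w"
  shows "u \<in> amb (s + t) w"
proof -
  from assms obtain \<sigma> \<tau> \<rho> where 1: "sw u s \<sigma> v" "sw u s \<tau> v" "\<sigma> \<noteq> \<tau>" "sw v t \<rho> w"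
    unfolding amb_iff_differing by blast
  then have "\<sigma> * \<rho> \<noteq> \<tau> * \<rho>"
    using sw_sign[OF 1(4)] by auto
  with 1 show ?thesis
    unfolding amb_iff_differing by (blast intro: sw_append)
qed

lemma amb_prepend:
  assumes "joined u s v" "v \<in> amb t w"
  shows "u \<in> amb (s + t) w"
proof -
  from assms obtain \<sigma> \<tau> \<rho> where 1: "sw v t \<sigma> w" "sw v t \<tau> w" "\<sigma> \<noteq> \<tau>" "sw u s \<rho> v"
    unfolding amb_iff_differing by blast
  then have "\<rho> * \<sigma> \<noteq> \<rho> * \<tau>"
    using sw_sign[OF 1(4)] by auto
  with 1 show ?thesis
    unfolding amb_iff_differing by (blast intro: sw_append)
qed

lemma joined_append: "joined u s v \<Longrightarrow> joined v t w \<Longrightarrow> joined u (s + t) w"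
  by (blast intro: sw_append)

lemma joined_splitE:
  assumes "joined u (s + t) w"
  obtains v where "joined u s v" "joined v t w"
  using assms by (blast elim: sw_splitE)

lemma joined_1: "joined u 1 v \<longleftrightarrow> (u, v) \<in> E"
  unfolding sw_1 by blast

lemma joined_mult: "joined u t u \<Longrightarrow> joined u (t * m) u"
proof (induction m)
  case 0
  then show ?case by (auto dest: sw_verts)
next
  case (Suc m)
  then show ?case
    using joined_append[of u t u "t * m" u] by simp
qed

end

section \<open>Growth of the sets of sources of SSSD pairs\<close>

text \<open>Before the chain reaches \<open>V\<close> every inclusion is strict, so each step
  contributes at least one element.\<close>

lemma card_chain_ge:
  fixes A :: "nat \<Rightarrow> 'b set"
  assumes "finite V" "\<And>j. A j \<subseteq> V" "\<And>j. A j \<subseteq> A (Suc j)"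
    and stationary: "\<And>j. A (Suc j) = A j \<Longrightarrow> A j = V"
  shows "card (A j) \<ge> min (card V) (card (A 0) + j)"
proof (induction j)
  case (Suc j)
  show ?case
  proof (cases "A (Suc j) = A j")
    case True
    then show ?thesis using stationary by auto
  next
    case False
    then have "card (A j) < card (A (Suc j))"
      using assms(1-3) by (intro psubset_card_mono finite_subset[OF _ assms(1)]) auto
    with Suc show ?thesis by linarith
  qed
qed auto

locale primitive_nonpowerful_digraph = signed_digraph +
  assumes primitive: "primitive (underlying S)"
    and nonpowerful: "nonpowerful S"
begin

abbreviation "n \<equiv> card V"

lemma finite_V [simp]: "finite V"
  by (rule pair_finite_verts)

section \<open>Walks in primitive digraphs and growth along closed walks\<close>

lemma obtain_uniform_length:
  obtains m where "m > 0" "\<And>u v. u \<in> V \<Longrightarrow> v \<in> V \<Longrightarrow> joined u m v"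
proof -
  obtain m where m: "m > 0" "\<And>u v. u \<in> V \<Longrightarrow> v \<in> V \<Longrightarrow> \<exists>p. awalk u p v \<and> length p = m"
    using primitive unfolding primitive_def by metis
  from m(2) have "joined u m v" if "u \<in> V" "v \<in> V" for u v
    using that unfolding signed_walk_def by metis
  with m(1) show thesis
    by (rule that)
qed

lemma obtain_ambiguous_pair:
  obtains u v t where "u \<in> amb t v"
  using nonpowerful unfolding nonpowerful_def amb_iff_SSSD by blast

lemma n_pos: "n > 0"
proof -
  obtain u v t where "u \<in> amb t v"
    by (rule obtain_ambiguous_pair)
  then show ?thesis
    using amb_subset by (auto simp: card_gt_0_iff)
qed

lemma obtain_out:
  assumes "u \<in> V"
  obtains v where "(u, v) \<in> E"
proof -
  obtain m where m: "m > 0" "\<And>u v. u \<in> V \<Longrightarrow> v \<in> V \<Longrightarrow> joined u m v"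
    using obtain_uniform_length by metis
  then have "joined u (1 + (m - 1)) u"
    using assms by simp
  then obtain v where "joined u 1 v"
    by (rule joined_splitE)
  then show thesis
    unfolding joined_1 by (rule that)
qed

lemma obtain_in:
  assumes "v \<in> V"
  obtains u where "(u, v) \<in> E"
proof -
  obtain m where m: "m > 0" "\<And>u v. u \<in> V \<Longrightarrow> v \<in> V \<Longrightarrow> joined u m v"
    using obtain_uniform_length by metis
  then have "joined v (m - 1 + 1) v"
    using assms by simp
  then obtain u where "joined u 1 v"
    by (rule joined_splitE)
  then show thesis
    unfolding joined_1 by (rule that)
qed

lemma obtain_walk_from:
  assumes "u \<in> V"
  obtains v where "joined u t v"
proof -
  have "\<exists>v. joined u t v"
  proof (induction t)
    case 0
    then show ?case using assms by auto
  next
    case (Suc t)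
    then obtain v where v: "joined u t v" by blast
    moreover obtain w where "(v, w) \<in> E"
      using v by (meson obtain_out sw_verts(2))
    ultimately have "joined u (t + 1) w"
      using joined_1 by (blast intro: joined_append)
    then show ?case by auto
  qed
  with that show thesis by blast
qed

lemma obtain_walk_to:
  assumes "v \<in> V"
  obtains u where "joined u t v"
proof -
  have "\<exists>u. joined u t v"
  proof (induction t)
    case 0
    then show ?case using assms by auto
  next
    case (Suc t)
    then obtain u where u: "joined u t v" by blast
    moreover obtain w where "(w, u) \<in> E"
      using u by (meson obtain_in sw_verts(1))
    ultimately have "joined w (1 + t) v"
      using joined_1 by (blast intro: joined_append)
    then show ?case by auto
  qed
  with that show thesis by blast
qed

text \<open>This is strong connectivity of the \<open>s\<close>-th power: with \<open>m\<close> the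
  uniform length, \<open>s - 1\<close> closed walks of length \<open>m\<close> at \<open>u\<close>
  and one walk of length \<open>m\<close> to \<open>v\<close> have total length
  \<open>s * m\<close>.\<close>

lemma joined_multiple:
  assumes "s > 0" "u \<in> V" "v \<in> V"
  obtains m where "joined u (s * m) v"
proof -
  obtain m where m: "m > 0" "\<And>u v. u \<in> V \<Longrightarrow> v \<in> V \<Longrightarrow> joined u m v"
    using obtain_uniform_length by metis
  have "joined u (m * (s - 1)) u"
    using m(2) assms by (intro joined_mult)
  then have "joined u (m * (s - 1) + m) v"
    using m(2) assms by (blast intro: joined_append)
  moreover have "m * (s - 1) + m = s * m"
    using assms(1) by (cases s) auto
  ultimately show thesis
    using that by metis
qed

text \<open>Every vertex starts a walk of length divisible by \<open>s\<close> that ends in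
  \<open>A\<close>; closedness carries membership back along its segments of length
  \<open>s\<close>.\<close>

lemma pred_closed_imp_all:
  assumes "s > 0" "A \<subseteq> V" "A \<noteq> {}" and closed: "\<And>u v. joined u s v \<Longrightarrow> v \<in> A \<Longrightarrow> u \<in> A"
  shows "A = V"
proof -
  have step: "joined u (s * m) v \<Longrightarrow> v \<in> A \<Longrightarrow> u \<in> A" for u v m
  proof (induction m arbitrary: u)
    case (Suc m)
    from Suc.prems(1) have "joined u (s + s * m) v" by simp
    then obtain x where "joined u s x" "joined x (s * m) v"
      by (rule joined_splitE)
    then show ?case
      using Suc closed by blast
  qed auto
  obtain v where "v \<in> A"
    using assms(3) by blast
  have "u \<in> A" if "u \<in> V" for u
  proof -
    obtain m where "joined u (s * m) v"
      using assms(1) \<open>u \<in> V\<close> \<open>v \<in> A\<close> assms(2) by (blast intro: joined_multiple)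
    then show ?thesis
      using \<open>v \<in> A\<close> by (rule step)
  qed
  with assms(2) show ?thesis by blast
qed

lemma succ_closed_imp_all:
  assumes "s > 0" "A \<subseteq> V" "A \<noteq> {}" and closed: "\<And>u v. joined u s v \<Longrightarrow> u \<in> A \<Longrightarrow> v \<in> A"
  shows "A = V"
proof (rule ccontr)
  assume "A \<noteq> V"
  then have "V - A \<noteq> {}"
    using assms(2) by blast
  moreover have "u \<in> V - A" if "joined u s v" "v \<in> V - A" for u v
  proof -
    have "u \<in> V"
      using that(1) by (auto dest: sw_verts)
    moreover have "u \<notin> A"
      using closed[OF that(1)] that(2) by auto
    ultimately show ?thesis by simp
  qed
  ultimately have "V - A = V"
    by (intro pred_closed_imp_all[OF assms(1)]) auto
  with assms(2,3) show False by blast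
qed

text \<open>Where the chain stalls, \<open>step\<close> makes \<open>A j\<close> closed under
  predecessors in the \<open>s\<close>-th power, so it is all of \<open>V\<close>.\<close>

lemma card_pred_chain_ge:
  assumes "s > 0" "\<And>j. A j \<subseteq> V" "\<And>j. A j \<subseteq> A (Suc j)" "A 0 \<noteq> {}"
    and step: "\<And>j u v. joined u s v \<Longrightarrow> v \<in> A j \<Longrightarrow> u \<in> A (Suc j)"
  shows "card (A j) \<ge> min n (Suc j)"
proof -
  have ne: "A j \<noteq> {}" for j
  proof (induction j)
    case (Suc j)
    then show ?case using assms(3)[of j] by auto
  qed (rule assms(4))
  have "A j = V" if "A (Suc j) = A j" for j
  proof (rule pred_closed_imp_all[OF assms(1,2) ne])
    show "u \<in> A j" if "joined u s v" "v \<in> A j" for u v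
      using step[OF that] \<open>A (Suc j) = A j\<close> by simp
  qed
  then have "card (A j) \<ge> min n (card (A 0) + j)"
    using assms(2,3) by (intro card_chain_ge) auto
  moreover have "card (A 0) > 0"
    using assms(4) finite_subset[OF assms(2)[of 0]] by (simp add: card_gt_0_iff)
  ultimately show ?thesis by linarith
qed

text \<open>Appending the closed walk at \<open>w\<close> to a pair makes the sets increase with
  \<open>j\<close>; prepending walks of length \<open>s\<close> supplies the new sources.\<close>

lemma ambiguous_growth:
  assumes "s > 0" "joined w s w" "amb t w \<noteq> {}"
  shows "card (amb (t + s * j) w) \<ge> min n (Suc j)"
proof (rule card_pred_chain_ge[where A = "\<lambda>j. amb (t + s * j) w" and s = s])
  fix j
  show "amb (t + s * j) w \<subseteq> amb (t + s * Suc j) w"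
  proof
    fix u
    assume "u \<in> amb (t + s * j) w"
    then have "u \<in> amb (t + s * j + s) w"
      using assms(2) by (rule amb_append)
    then show "u \<in> amb (t + s * Suc j) w"
      by (simp add: algebra_simps)
  qed
next
  fix j u v
  assume "joined u s v" "v \<in> amb (t + s * j) w"
  then have "u \<in> amb (s + (t + s * j)) w"
    by (rule amb_prepend)
  then show "u \<in> amb (t + s * Suc j) w"
    by (simp add: algebra_simps)
qed (use assms amb_subset in auto)

text \<open>
  If no vertex has an SSSD pair of length \<open>s n\<close> to \<open>w\<close>, then every vertex \<open>u\<close> has a well-defined
  sign \<open>c u\<close> of its walks of length \<open>s (n - 1)\<close> to \<open>w\<close>. Comparing the two ways of reaching \<open>w\<close> in
  \<open>s n\<close> steps shows that every walk of length \<open>s\<close> from \<open>u\<close> to \<open>v\<close> has sign \<open>\<epsilon> c(u) c(v)\<close>, where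
  \<open>\<epsilon>\<close> is the sign of the closed walk at \<open>w\<close>, so no two walks of equal length divisible by \<open>s\<close>
  form an SSSD pair.
\<close>
lemma ambiguous_nonempty:
  assumes "s > 0" "joined w s w"
  shows "amb (s * n) w \<noteq> {}"
proof
  assume empty: "amb (s * n) w = {}"
  have unique: "\<sigma> = \<tau>" if "sw u (s * n) \<sigma> w" "sw u (s * n) \<tau> w" for u \<sigma> \<tau>
    using empty that amb_iff_differing by blast
  \<comment> \<open>The sets \<open>B j\<close> grow from \<open>{w}\<close>, so after
    \<open>n - 1\<close> rounds every vertex reaches \<open>w\<close> in exactly
    \<open>s * (n - 1)\<close> steps. This is what makes the choice of \<open>c\<close> below
    meaningful.\<close>
  define B where "B j = {u. joined u (s * j) w}" for j
  have "card (B (n - 1)) \<ge> min n (Suc (n - 1))"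
  proof (rule card_pred_chain_ge[OF assms(1)])
    fix j
    show "B j \<subseteq> B (Suc j)"
    proof
      fix u assume "u \<in> B j"
      then have "joined u (s * j + s) w"
        using assms(2) unfolding B_def by (blast intro: joined_append)
      then show "u \<in> B (Suc j)"
        by (simp add: B_def algebra_simps)
    qed
    show "B j \<subseteq> V"
      unfolding B_def using sw_verts by auto
    show "u \<in> B (Suc j)" if "joined u s v" "v \<in> B j" for u v
      using joined_append[of u s v "s * j" w] that by (simp add: B_def)
  next
    show "B 0 \<noteq> {}"
      using assms(2) by (auto simp: B_def dest: sw_verts)
  qed
  moreover have "B (n - 1) \<subseteq> V"
    unfolding B_def using sw_verts by auto
  ultimately have B_V: "B (n - 1) = V"
    using n_pos by (intro card_seteq) auto
  define c where "c u = (SOME \<sigma>. sw u (s * (n - 1)) \<sigma> w)" for u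
  have c: "sw u (s * (n - 1)) (c u) w" if "u \<in> V" for u
  proof -
    have "\<exists>\<sigma>. sw u (s * (n - 1)) \<sigma> w"
      using that B_V unfolding B_def by blast
    then show ?thesis
      unfolding c_def by (rule someI_ex)
  qed
  have c_square: "c u * c u = 1" if "u \<in> V" for u
    using c[OF that] sw_sign_square by blast
  obtain \<epsilon> where \<epsilon>: "sw w s \<epsilon> w"
    using assms(2) by blast
  have sn: "s + s * (n - 1) = s * n" "s * (n - 1) + s = s * n"
    using n_pos mult_Suc_right[of s "n - 1"] by (simp_all add: add.commute del: One_nat_def)
  have step: "\<tau> = \<epsilon> * c u * c v" if "sw u s \<tau> v" for u v \<tau>
  proof -
    have uv: "u \<in> V" "v \<in> V"
      using that sw_verts by auto
    have "sw u (s * n) (\<tau> * c v) w"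
      using sw_append[OF that c[OF uv(2)]] unfolding sn .
    moreover have "sw u (s * n) (c u * \<epsilon>) w"
      using sw_append[OF c[OF uv(1)] \<epsilon>] unfolding sn .
    ultimately have "\<tau> * c v = c u * \<epsilon>"
      by (rule unique)
    then have "\<tau> * (c v * c v) = \<epsilon> * c u * c v"
      by (simp add: algebra_simps)
    then show ?thesis
      using c_square[OF uv(2)] by simp
  qed
  have power: "\<tau> = \<epsilon> ^ j * c u * c v" if "sw u (s * j) \<tau> v" for u v j \<tau>
    using that
  proof (induction j arbitrary: u \<tau>)
    case 0
    then show ?case using c_square by auto
  next
    case (Suc j)
    from Suc.prems have "sw u (s + s * j) \<tau> v" by simp
    then obtain x \<tau>1 \<tau>2 where x: "sw u s \<tau>1 x" "sw x (s * j) \<tau>2 v" "\<tau> = \<tau>1 * \<tau>2"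
      by (rule sw_splitE)
    have "\<tau> = \<epsilon> * \<epsilon> ^ j * c u * c v * (c x * c x)"
      using step[OF x(1)] Suc.IH[OF x(2)] x(3) by (simp add: algebra_simps)
    then show ?case
      using c_square x(1) sw_verts(2) by simp
  qed
  obtain x y t where xy: "x \<in> amb t y"
    by (rule obtain_ambiguous_pair)
  then have "y \<in> V"
    using sw_verts(2) unfolding ambiguous_def by blast
  \<comment> \<open>The given pair has an arbitrary length \<open>t\<close>; continuing it for
    \<open>t * (s - 1)\<close> steps makes the length \<open>s * t\<close>, where
    \<open>power\<close> leaves only one sign.\<close>
  then obtain z where "joined y (t * (s - 1)) z"
    by (rule obtain_walk_from)
  with xy have "x \<in> amb (t + t * (s - 1)) z"
    by (rule amb_append)
  moreover have "t + t * (s - 1) = s * t"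
    using assms(1) by (cases s) auto
  ultimately show False
    using power unfolding amb_iff_differing by metis
qed

lemma ambiguous_nonempty_later:
  assumes "amb t v \<noteq> {}" "t \<le> t'"
  shows "amb t' v \<noteq> {}"
proof -
  obtain u where u: "u \<in> amb t v"
    using assms(1) by blast
  moreover obtain x where "joined x (t' - t) u"
    using u amb_subset by (meson obtain_walk_to subsetD)
  ultimately have "x \<in> amb (t' - t + t) v"
    by (intro amb_prepend)
  then show ?thesis
    using assms(2) by auto
qed

section \<open>Covering sets and bounds for the upper base\<close>

definition covers :: "'a set \<Rightarrow> nat \<Rightarrow> bool" where
  "covers X p \<longleftrightarrow> (\<forall>v\<in>V. X \<inter> amb p v \<noteq> {})"

lemma base_set_eq: "base_set S X = (LEAST p. covers X p)"
  unfolding base_set_def covers_def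
  by (rule arg_cong[where f = Least]) (auto simp: fun_eq_iff amb_iff_SSSD[symmetric] Bex_def)

text \<open>Every vertex has an incoming arc, so a pair ending at its predecessor extends by one
  step. Hence a single length at which \<open>X\<close> fails to cover bounds
  \<open>base_set\<close> from below.\<close>

lemma covers_mono:
  assumes "covers X p" "p \<le> q"
  shows "covers X q"
  using assms(2)
proof (induction q rule: dec_induct)
  case base
  then show ?case using assms(1) .
next
  case (step q)
  show ?case
    unfolding covers_def
  proof
    fix v assume "v \<in> V"
    then obtain u where u: "(u, v) \<in> E"
      by (rule obtain_in)
    then obtain x where "x \<in> X" "x \<in> amb q u"
      using step wellformed'(1) unfolding covers_def by blast
    then have "x \<in> amb (q + 1) v"
      using u joined_1 by (blast intro: amb_append)
    with \<open>x \<in> X\<close> show "X \<inter> amb (Suc q) v \<noteq> {}" by auto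
  qed
qed

text \<open>Pigeonhole: two subsets of \<open>V\<close> whose sizes add up to more than
  \<open>n\<close> must meet.\<close>

lemma covers_if_card:
  assumes "X \<subseteq> V" "card X = k" "\<And>v. v \<in> V \<Longrightarrow> card (amb p v) + k > n"
  shows "covers X p"
  unfolding covers_def
proof (intro ballI notI)
  fix v assume v: "v \<in> V" "X \<inter> amb p v = {}"
  have "card X + card (amb p v) = card (X \<union> amb p v)"
    using assms(1) v(2) amb_subset[of p v]
    by (intro card_Un_disjoint[symmetric]) (auto intro: finite_subset)
  also have "\<dots> \<le> n"
    using assms(1) amb_subset by (intro card_mono) auto
  finally show False
    using assms(2,3) v(1) by fastforce
qed

lemma upper_base_eq: "upper_base S k = Max (base_set S ` {X. X \<subseteq> V \<and> card X = k})"
  unfolding upper_base_def by (simp add: image_def Setcompr_eq_image conj_commute)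

lemma upper_base_le:
  assumes "k \<le> n" "\<And>v. v \<in> V \<Longrightarrow> card (amb p v) + k > n"
  shows "upper_base S k \<le> p"
proof -
  obtain X0 where "X0 \<subseteq> V" "card X0 = k"
    using assms(1) by (meson obtain_subset_with_card_n)
  moreover have "base_set S X \<le> p" if "X \<subseteq> V" "card X = k" for X
    unfolding base_set_eq using covers_if_card[OF that assms(2)] by (intro Least_le)
  ultimately show ?thesis
    unfolding upper_base_eq by (subst Max_le_iff) auto
qed

text \<open>After \<open>n - k\<close> rounds along the closed walk at least
  \<open>n - k + 1\<close> vertices have a pair to \<open>w\<close>, too many to avoid a
  \<open>k\<close>-set; the last \<open>r\<close> steps lead from \<open>w\<close> to
  \<open>v\<close>.\<close>

lemma card_ambiguous_of_closed_walks:
  assumes "s > 0" "1 \<le> k" "k \<le> n"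
    and "joined w r v" "joined w s w" "amb t w \<noteq> {}"
  shows "n < card (amb (t + s * (n - k) + r) v) + k"
proof -
  have "n - k + 1 \<le> card (amb (t + s * (n - k)) w)"
    using ambiguous_growth[OF assms(1,5,6), of "n - k"] assms(2,3) by auto
  also have "\<dots> \<le> card (amb (t + s * (n - k) + r) v)"
    using amb_append[OF _ assms(4)] by (intro card_mono finite_subset[OF amb_subset]) auto
  finally show ?thesis
    using assms(2,3) by linarith
qed

lemma upper_base_le_of_closed_walks:
  assumes "s > 0" "1 \<le> k" "k \<le> n"
    and "\<And>v. v \<in> V \<Longrightarrow> \<exists>w. joined w r v \<and> joined w s w \<and> amb t w \<noteq> {}"
  shows "upper_base S k \<le> t + s * (n - k) + r"
  using assms card_ambiguous_of_closed_walks by (intro upper_base_le) blast+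

lemma upper_base_greater:
  assumes "1 \<le> k" "X \<subseteq> V" "card X = k" "v \<in> V" "X \<inter> amb p v = {}"
  shows "p < upper_base S k"
proof -
  obtain m where m: "m > 0" "\<And>u v. u \<in> V \<Longrightarrow> v \<in> V \<Longrightarrow> joined u m v"
    using obtain_uniform_length by metis
  have "k \<le> n"
    using assms(2,3) card_mono[of V X] by simp
  \<comment> \<open>\<open>LEAST\<close> yields a covering length only once one is known to exist.
    Here the uniform length \<open>m\<close> serves both as the length of a closed walk at
    \<open>v\<close> and as the number of final steps.\<close>
  have "n < card (amb (m * n + m * (n - k) + m) v) + k" if "v \<in> V" for v
    using m(2)[OF that that] m(1)
    by (intro card_ambiguous_of_closed_walks assms(1) \<open>k \<le> n\<close> ambiguous_nonempty)
  then have "covers X (m * n + m * (n - k) + m)"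
    using assms(2,3) by (intro covers_if_card)
  then have least: "covers X (base_set S X)"
    unfolding base_set_eq by (rule LeastI)
  have "\<not> covers X p"
    using assms(4,5) unfolding covers_def by blast
  then have "p < base_set S X"
    using covers_mono[OF least] by (meson not_le)
  also have "base_set S X \<le> upper_base S k"
    unfolding upper_base_eq using assms(2,3) by (intro Max_ge) auto
  finally show ?thesis .
qed

end

section \<open>Shortest cycles\<close>

lemma parcs_D1: "parcs (D1 (Suc s)) = (\<lambda>k. (Suc k, Suc (Suc k))) ` {..<s} \<union> {(Suc s, 1), (s, 1)}"
proof -
  have "{(i, i + 1) |i. 1 \<le> i \<and> i \<le> s} = (\<lambda>k. (Suc k, Suc (Suc k))) ` {..<s}"
  proof (intro equalityI subsetI)
    fix e
    assume "e \<in> {(i, i + 1) |i. 1 \<le> i \<and> i \<le> s}"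
    then obtain i where "e = (i, i + 1)" "1 \<le> i" "i \<le> s"
      by blast
    then show "e \<in> (\<lambda>k. (Suc k, Suc (Suc k))) ` {..<s}"
      by (intro image_eqI[of _ _ "i - 1"]) auto
  qed auto
  then show ?thesis
    by (simp add: D1_def)
qed

context primitive_nonpowerful_digraph
begin

text \<open>The cycle is an \<open>s\<close>-periodic sequence, so that indices may run past
  \<open>s\<close> and be shifted freely. Minimality is required against all closed walks of
  positive length, which is the form in which shortcuts are refuted.\<close>

definition shortest_cycle :: "nat \<Rightarrow> (nat \<Rightarrow> 'a) \<Rightarrow> bool" where
  "shortest_cycle s f \<longleftrightarrow> s > 0 \<and> (\<forall>k. f (k + s) = f k) \<and> (\<forall>k. (f k, f (Suc k)) \<in> E) \<and>
     (\<forall>u m. 0 < m \<longrightarrow> joined u m u \<longrightarrow> s \<le> m)"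

lemma joined_along:
  assumes "\<And>k. a \<le> k \<Longrightarrow> k < b \<Longrightarrow> (f k, f (Suc k)) \<in> E" "a \<le> b" "f a \<in> V"
  shows "joined (f a) (b - a) (f b)"
  using assms(2,1)
proof (induction b rule: dec_induct)
  case base
  then show ?case using assms(3) by auto
next
  case (step b)
  then have "joined (f a) (b - a + 1) (f (Suc b))"
    using joined_1 by (intro joined_append) auto
  then show ?case
    using step.hyps by (simp add: Suc_diff_le)
qed

lemma joined_imp_sequence:
  assumes "joined u t v"
  shows "\<exists>g. g 0 = u \<and> g t = v \<and> (\<forall>i<t. (g i, g (Suc i)) \<in> E)"
  using assms
proof (induction t arbitrary: v)
  case 0
  then show ?case by (auto intro: exI[of _ "\<lambda>_. u"])
next
  case (Suc t)
  then have "joined u (t + 1) v" by simp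
  then obtain x where x: "joined u t x" "(x, v) \<in> E"
    by (elim joined_splitE) (unfold joined_1, blast)
  then obtain g where g: "g 0 = u" "g t = x" "\<And>i. i < t \<Longrightarrow> (g i, g (Suc i)) \<in> E"
    using Suc.IH by metis
  show ?case
    using g x(2) by (intro exI[of _ "g(Suc t := v)"]) (auto simp: less_Suc_eq)
qed

lemma obtain_shortest_cycle:
  obtains s f where "shortest_cycle s f"
proof -
  define P where "P s \<longleftrightarrow> s > 0 \<and> (\<exists>u. joined u s u)" for s
  define s where "s = (LEAST s. P s)"
  obtain v where "v \<in> V"
    using n_pos by fastforce
  then have "\<exists>m. P m"
    unfolding P_def by (meson obtain_uniform_length)
  then have "P s"
    unfolding s_def by (rule LeastI_ex)
  then obtain u where s: "s > 0" "joined u s u"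
    unfolding P_def by blast
  have least: "s \<le> m" if "m > 0" "joined v m v" for v m
    using that unfolding s_def P_def by (intro Least_le) blast
  obtain g where g: "g 0 = u" "g s = u" "\<And>i. i < s \<Longrightarrow> (g i, g (Suc i)) \<in> E"
    using joined_imp_sequence[OF s(2)] by blast
  have "(g (k mod s), g (Suc k mod s)) \<in> E" for k
  proof (cases "Suc (k mod s) = s")
    case True
    then show ?thesis using g(3)[of "k mod s"] g(1,2) s(1) by (simp add: mod_Suc)
  next
    case False
    then show ?thesis using g(3)[of "k mod s"] s(1) by (simp add: mod_Suc)
  qed
  then have "shortest_cycle s (\<lambda>k. g (k mod s))"
    unfolding shortest_cycle_def using s(1) least by simp
  with that show thesis .
qed

section \<open>Distances along a shortest cycle and the girth bound\<close>

context
  fixes s f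
  assumes cyc: "shortest_cycle s f"
begin

lemma cycle_pos: "s > 0"
  and cycle_periodic: "f (k + s) = f k"
  and cycle_arc: "(f k, f (Suc k)) \<in> E"
  and cycle_least: "0 < m \<Longrightarrow> joined u m u \<Longrightarrow> s \<le> m"
  using cyc unfolding shortest_cycle_def by blast+

lemma cycle_in_V: "f k \<in> V"
  using cycle_arc wellformed'(1) by blast

lemma cycle_joined: "joined (f i) t (f (i + t))"
  using joined_along[of i "i + t" f] cycle_arc cycle_in_V by simp

lemma cycle_inj: "inj_on f {..<s}"
proof -
  have "f i \<noteq> f j" if "i < j" "j < s" for i j
  proof
    assume "f i = f j"
    then have "joined (f i) (j - i) (f i)"
      using cycle_joined[of i "j - i"] that by simp
    then show False
      using cycle_least[of "j - i" "f i"] that by simp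
  qed
  then show ?thesis
    by (auto simp: inj_on_def) (metis linorder_neqE_nat)
qed

lemma cycle_mod: "f (k mod s) = f k"
proof -
  have "f (r + s * m) = f r" for r m
  proof (induction m)
    case (Suc m)
    then show ?case using cycle_periodic[of "r + s * m"] by (simp add: algebra_simps)
  qed simp
  from this[of "k mod s" "k div s"] show ?thesis by simp
qed

lemma range_cycle: "range f = f ` {..<s}"
  using cycle_pos cycle_mod by (metis (no_types, lifting) UNIV_I imageE image_eqI lessThan_iff
      mod_less_divisor subsetI subset_antisym top_greatest image_mono)

lemma cycle_card: "card (range f) = s"
  using cycle_inj by (simp add: range_cycle card_image)

lemma cycle_length_le: "s \<le> n"
  using cycle_card cycle_in_V card_mono[of V "range f"] by auto

lemma rotate_cycle: "shortest_cycle s (\<lambda>k. f (k + c))"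
proof -
  have "f (k + s + c) = f (k + c)" for k
    using cycle_periodic[of "k + c"] by (simp add: ac_simps)
  then show ?thesis
    unfolding shortest_cycle_def using cycle_pos cycle_arc cycle_least by simp
qed

text \<open>Starting one vertex earlier on the cycle turns a walk of length \<open>j\<close> into
  one of length \<open>j + 1\<close>, so the reached sets increase. They start with the
  \<open>s\<close> cycle vertices and gain at least one vertex per step.\<close>

lemma reach_from_cycle:
  assumes "v \<in> V"
  shows "\<exists>k. joined (f k) (n - s) v"
proof -
  define A where "A j = {v. \<exists>k. joined (f k) j v}" for j
  have A_V: "A j \<subseteq> V" for j
    unfolding A_def by (auto dest: sw_verts)
  have A0: "A 0 = range f"
    unfolding A_def using cycle_in_V by auto
  have mono: "A j \<subseteq> A (Suc j)" for j
  proof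
    fix v assume "v \<in> A j"
    then obtain k where k: "joined (f k) j v"
      unfolding A_def by blast
    have "joined (f (k + (s - 1))) 1 (f k)"
      using cycle_joined[of "k + (s - 1)" 1] cycle_pos cycle_periodic[of k] by simp
    then have "joined (f (k + (s - 1))) (1 + j) v"
      using k by (rule joined_append)
    then show "v \<in> A (Suc j)"
      unfolding A_def by auto
  qed
  have ne: "A j \<noteq> {}" for j
    using cycle_joined[of 0 j] unfolding A_def by blast
  have "A j = V" if "A (Suc j) = A j" for j
  proof (rule succ_closed_imp_all[OF zero_less_one A_V ne])
    fix u v assume "joined u 1 v" "u \<in> A j"
    then obtain k where "joined (f k) (j + 1) v"
      unfolding A_def using joined_append by blast
    then have "v \<in> A (Suc j)"
      unfolding A_def by auto
    with that show "v \<in> A j" by simp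
  qed
  then have "card (A (n - s)) \<ge> min n (card (A 0) + (n - s))"
    using A_V mono by (intro card_chain_ge) auto
  then have "card (A (n - s)) \<ge> n"
    using cycle_length_le cycle_card A0 by simp
  then have "A (n - s) = V"
    using A_V by (intro card_seteq) auto
  with assms show ?thesis
    unfolding A_def by blast
qed

lemma upper_base_le_girth:
  assumes "1 \<le> k" "k \<le> n"
  shows "upper_base S k \<le> s * n + s * (n - k) + (n - s)"
proof (rule upper_base_le_of_closed_walks[OF cycle_pos assms])
  fix v assume "v \<in> V"
  then obtain i where "joined (f i) (n - s) v"
    using reach_from_cycle by blast
  moreover have "joined (f i) s (f i)"
    using cycle_joined[of i s] cycle_periodic by simp
  ultimately show "\<exists>w. joined w (n - s) v \<and> joined w s w \<and> amb (s * n) w \<noteq> {}"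
    using ambiguous_nonempty[OF cycle_pos] by blast
qed

text \<open>Closing the walk up along the cycle gives a closed walk, which cannot be shorter than
  \<open>s\<close>. The way back from \<open>f j\<close> to \<open>f i\<close> has length
  \<open>i - j\<close>, or \<open>s + i - j\<close> if it passes \<open>f 0\<close>.\<close>

lemma cycle_return:
  assumes "i < s" "j < s" "joined (f i) d (f j)" "d > 0"
  shows "j \<le> i \<Longrightarrow> s \<le> d + (i - j)" and "i < j \<Longrightarrow> j \<le> i + d"
proof -
  assume "j \<le> i"
  then have "joined (f i) (d + (i - j)) (f i)"
    using assms(3) cycle_joined[of j "i - j"] by (intro joined_append) auto
  then show "s \<le> d + (i - j)"
    using cycle_least[of "d + (i - j)"] assms(4) by simp
next
  assume "i < j"
  then have "joined (f i) (d + (s + i - j)) (f i)"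
    using assms(2,3) cycle_joined[of j "s + i - j"] cycle_periodic[of i]
    by (intro joined_append) (auto simp: add.commute)
  then have "s \<le> d + (s + i - j)"
    using cycle_least[of "d + (s + i - j)"] assms(4) by simp
  then show "j \<le> i + d"
    using assms(2) \<open>i < j\<close> by linarith
qed

lemma chordless:
  assumes "i < s" "j < s" "(f i, f j) \<in> E"
  shows "j = Suc i mod s"
  using cycle_return[of i j 1] assms joined_1 by (cases "j \<le> i") (auto simp: mod_Suc)

end

section \<open>Girth \<open>n\<close> is impossible, girth \<open>n - 1\<close> gives
  \<open>D1\<close> or \<open>D2\<close>\<close>

lemma no_colouring:
  assumes col: "\<And>u v. (u, v) \<in> E \<Longrightarrow> col v mod s = Suc (col u) mod s"
    and "u \<in> V" "v \<in> V"
  shows "col u mod s = (col v :: nat) mod s"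
proof -
  have walk: "col y mod s = (col x + t) mod s" if "joined x t y" for x y t
    using that
  proof (induction t arbitrary: y)
    case (Suc t)
    then have "joined x (t + 1) y" by simp
    then obtain z where z: "joined x t z" "(z, y) \<in> E"
      by (elim joined_splitE) (unfold joined_1, blast)
    then have "col y mod s = Suc (col z mod s) mod s"
      using col by (simp add: mod_Suc_eq)
    then show ?case
      using Suc.IH[OF z(1)] by (simp add: mod_Suc_eq)
  qed auto
  \<comment> \<open>By \<open>walk\<close>, lengths modulo \<open>s\<close> are differences of
    colours. As one length \<open>m\<close> joins \<open>u\<close> both to itself and to
    \<open>v\<close>, the two colours agree.\<close>
  obtain m where m: "\<And>u v. u \<in> V \<Longrightarrow> v \<in> V \<Longrightarrow> joined u m v"
    using obtain_uniform_length by metis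
  show ?thesis
    using walk[OF m[of u u]] walk[OF m[of u v]] assms(2,3) by simp
qed

text \<open>A shortest cycle through all vertices has no chords, so the position on it is a
  colouring that every arc advances by one; \<open>f 0\<close> and \<open>f 1\<close> then
  contradict \<open>no_colouring\<close>.\<close>

lemma girth_less:
  assumes cyc: "shortest_cycle s f" and "n \<ge> 2"
  shows "s < n"
proof (rule ccontr)
  assume "\<not> s < n"
  then have s: "s = n"
    using cycle_length_le[OF cyc] by simp
  have V: "range f = V"
    using cycle_card[OF cyc] cycle_in_V[OF cyc] s by (intro card_seteq) auto
  define col where "col = the_inv_into {..<s} f"
  have col: "col (f i) = i" if "i < s" for i
    unfolding col_def using cycle_inj[OF cyc] that by (simp add: the_inv_into_f_f)
  have "col v mod s = Suc (col u) mod s" if "(u, v) \<in> E" for u v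
  proof -
    have "u \<in> f ` {..<s}" "v \<in> f ` {..<s}"
      using that wellformed' V range_cycle[OF cyc] by auto
    then obtain i j where "i < s" "j < s" "u = f i" "v = f j"
      by blast
    then show ?thesis
      using chordless[OF cyc] that col by simp
  qed
  then have "col (f 0) mod s = col (f 1) mod s"
    using cycle_in_V[OF cyc] by (intro no_colouring)
  then show False
    using col s assms(2) by simp
qed

text \<open>An isomorphism taken from the standard digraph to \<open>S\<close>, so that vertices of
  \<open>S\<close> are addressed by numbers; \<open>digraph_iso_pair\<close> relates it to
  \<open>digraph_iso\<close>.\<close>

definition labelling :: "(nat \<Rightarrow> 'a) \<Rightarrow> nat pair_pre_digraph \<Rightarrow> bool" where
  "labelling h D \<longleftrightarrow> bij_betw h (pverts D) V \<and> E = map_prod h h ` parcs D"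

lemma labellingI:
  assumes "inj_on h {1..n}" "h ` {1..n} \<subseteq> V" "pverts D = {1..n}" "E = map_prod h h ` parcs D"
  shows "labelling h D"
proof -
  have "h ` {1..n} = V"
    using assms(1,2) by (intro card_seteq) (auto simp: card_image)
  with assms show ?thesis
    by (auto simp: labelling_def bij_betw_def)
qed

lemma girth_pred_order:
  assumes cyc0: "shortest_cycle s f0" and n: "n = Suc s" "s \<ge> 4"
  shows "\<exists>h. labelling h (D1 n) \<or> labelling h (D2 n)"
proof -
  \<comment> \<open>If \<open>f i \<rightarrow> z \<rightarrow> f j\<close> for the vertex \<open>z\<close> off the cycle, then \<open>j\<close> is \<open>i + 1\<close> or \<open>i + 2\<close> modulo \<open>s\<close>.
    If it is always \<open>i + 2\<close>, then \<open>z\<close> is a twin of \<open>f (i + 1)\<close> and all cycle lengths are divisible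
    by \<open>s\<close>; otherwise \<open>z\<close> can be inserted into the cycle, and the cycle is rotated such that \<open>z\<close>
    comes between \<open>f (s - 1)\<close> and \<open>f 0\<close>.\<close>
  have "card (V - range f0) = 1"
    using cycle_card[OF cyc0] cycle_in_V[OF cyc0] n finite_subset[of "range f0" V]
    by (subst card_Diff_subset) auto
  then obtain z where z0: "V - range f0 = {z}"
    by (auto simp: card_1_singleton_iff)
  have rotate_range: "range (\<lambda>k. f (k + c)) = range f" if "shortest_cycle s f" for f c
  proof (rule card_subset_eq)
    show "finite (range f)"
      using cycle_in_V[OF that] by (intro finite_subset[OF _ finite_V]) auto
  qed (use cycle_card[OF that] cycle_card[OF rotate_cycle[OF that]] in auto)
  define good where "good f \<longleftrightarrow> shortest_cycle s f \<and> V - range f = {z}" for f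
  have good_rotate: "good (\<lambda>k. f (k + c))" if "good f" for f c
    using that rotate_range rotate_cycle unfolding good_def by auto
  have z: "z \<in> V"
    using z0 by blast
  have no_loop: "(z, z) \<notin> E"
    using cycle_least[OF cyc0, of 1 z] n joined_1[of z z] by auto
  have in_good: "\<exists>i<s. u = f i" if "good f" "u \<in> V" "u \<noteq> z" for f u
    using that range_cycle unfolding good_def by blast
  have through: "(j \<le> i \<longrightarrow> s \<le> 2 + (i - j)) \<and> (i < j \<longrightarrow> j \<le> i + 2)"
    if "good f" "i < s" "j < s" "(f i, z) \<in> E" "(z, f j) \<in> E" for f i j
  proof -
    have "joined (f i) (1 + 1) (f j)"
      using that(4,5) joined_1 by (intro joined_append[of "f i" 1 z]) auto
    then have "joined (f i) 2 (f j)"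
      unfolding one_add_one .
    then show ?thesis
      using cycle_return[of s f i j 2] that(1-3) unfolding good_def by auto
  qed
  have "\<exists>f. good f \<and> (f (s - 1), z) \<in> E \<and> (z, f 0) \<in> E"
  proof (rule ccontr)
    assume none: "\<not> ?thesis"
    obtain u where "(u, z) \<in> E"
      using z by (rule obtain_in)
    then obtain i where i: "i < s" "(f0 i, z) \<in> E"
      using in_good[of f0 u] no_loop cyc0 z0 wellformed'(1) unfolding good_def by blast
    \<comment> \<open>The rotation puts the predecessor \<open>f0 i\<close> of \<open>z\<close> at
      position \<open>s - 1\<close>.\<close>
    define f where "f k = f0 (k + Suc i)" for k
    have f: "good f"
      unfolding f_def using cyc0 z0 by (intro good_rotate) (simp add: good_def)
    have fz: "(f (s - 1), z) \<in> E"
      using i cycle_periodic[OF cyc0, of i] n by (simp add: f_def add.commute)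
    have zf: "j = 1" if "(z, f j) \<in> E" "j < s" for j
    proof -
      have "j \<noteq> 0"
        using none f fz that by metis
      moreover have "j \<le> 1"
        using through[OF f _ that(2) fz that(1)] that(2) n by auto
      ultimately show ?thesis by simp
    qed
    obtain v where v: "(z, v) \<in> E"
      using z by (rule obtain_out)
    then obtain j where "j < s" "v = f j"
      using in_good[OF f] no_loop wellformed'(2) by blast
    then have zf1: "(z, f 1) \<in> E"
      using zf v by metis
    \<comment> \<open>Otherwise \<open>f 0 -> z -> f 1\<close>, and rotating by one more step would
      let \<open>z\<close> be inserted.\<close>
    have f0z: "(f 0, z) \<notin> E"
    proof
      assume "(f 0, z) \<in> E"
      moreover have "f (s - 1 + 1) = f 0"
        using cycle_periodic[of s f 0] f n unfolding good_def by simp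
      ultimately show False
        using none[unfolded not_ex, rule_format, of "\<lambda>k. f (k + 1)"] good_rotate[OF f, of 1] zf1
        by simp
    qed
    have fz_only: "i = s - 1" if "(f i, z) \<in> E" "i < s" for i
      using through[OF f that(2) _ that(1) zf1] that f0z n by (cases "i = 0") auto
    have cyc: "shortest_cycle s f"
      using f by (simp add: good_def)
    have zC: "z \<notin> range f"
      using f by (auto simp: good_def)
    \<comment> \<open>All arcs at \<open>z\<close> come from \<open>f (s - 1)\<close> or go to
      \<open>f 1\<close>, so \<open>z\<close> gets the colour 0 of its twin
      \<open>f 0\<close>.\<close>
    define col where "col v = (if v = z then 0 else the_inv_into {..<s} f v)" for v
    have col: "col (f i) = i" if "i < s" for i
      unfolding col_def using cycle_inj[OF cyc] that zC by (auto simp: the_inv_into_f_f)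
    have "col v mod s = Suc (col u) mod s" if uv: "(u, v) \<in> E" for u v
    proof -
      have uvV: "u \<in> V" "v \<in> V"
        using uv wellformed' by auto
      consider "u = z" | "u \<noteq> z" "v = z" | "u \<noteq> z" "v \<noteq> z" by blast
      then show ?thesis
      proof cases
        case 1
        then obtain j where "j < s" "v = f j"
          using in_good[OF f uvV(2)] uv no_loop by blast
        then have "v = f 1"
          using zf uv 1 by metis
        then show ?thesis
          using 1 col[of 1] n by (simp add: col_def)
      next
        case 2
        then obtain i where "i < s" "u = f i"
          using in_good[OF f uvV(1)] by blast
        then have "u = f (s - 1)"
          using fz_only uv 2 by metis
        then show ?thesis
          using 2 col[of "s - 1"] n by (simp add: col_def)
      next
        case 3
        then obtain i j where "i < s" "j < s" "u = f i" "v = f j"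
          using in_good[OF f] uvV by metis
        then show ?thesis
          using chordless[OF cyc] uv col by simp
      qed
    qed
    then have "col (f 0) mod s = col (f 1) mod s"
      using cycle_in_V[OF cyc] by (intro no_colouring)
    then show False
      using col n by simp
  qed
  then obtain f where f: "good f" and fz: "(f (s - 1), z) \<in> E" and zf: "(z, f 0) \<in> E"
    by blast
  have cyc: "shortest_cycle s f" and zC: "z \<notin> range f" and V: "V = insert z (range f)"
    using f z cycle_in_V unfolding good_def by auto
  have fz_only: "i = s - 1 \<or> i = s - 2" if "(f i, z) \<in> E" "i < s" for i
    using through[OF f that(2) _ that(1) zf] that(2) n by auto
  have zf_only: "j = 0 \<or> j = 1" if "(z, f j) \<in> E" "j < s" for j
    using through[OF f _ that(2) fz that(1)] that(2) n by auto
  \<comment> \<open>With both arcs, \<open>f (s - 2) -> z -> f 1\<close> and the cycle from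
    \<open>f 1\<close> to \<open>f (s - 2)\<close> would close up in
    \<open>2 + (s - 3) = s - 1\<close> steps.\<close>
  have not_both: "\<not> ((f (s - 2), z) \<in> E \<and> (z, f 1) \<in> E)"
    using through[OF f, of "s - 2" 1] n by auto
  have inj: "f i = f j \<longleftrightarrow> i = j" if "i < s" "j < s" for i j
    using cycle_inj[OF cyc] that by (auto simp: inj_on_def)
  have fs: "f s = f 0"
    using cycle_periodic[OF cyc, of 0] by simp
  have arcs: "(u, v) \<in> E \<longleftrightarrow> (\<exists>k<s. u = f k \<and> v = f (Suc k)) \<or> (u, v) = (f (s - 1), z) \<or> (u, v) = (z, f 0)
      \<or> ((f (s - 2), z) \<in> E \<and> (u, v) = (f (s - 2), z)) \<or> ((z, f 1) \<in> E \<and> (u, v) = (z, f 1))"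
    (is "_ \<longleftrightarrow> ?R") for u v
  proof
    assume uv: "(u, v) \<in> E"
    then have uvV: "u \<in> V" "v \<in> V"
      using wellformed' by auto
    consider "u = z" | "u \<noteq> z" "v = z" | "u \<noteq> z" "v \<noteq> z" by blast
    then show ?R
    proof cases
      case 1
      then obtain j where "j < s" "v = f j"
        using in_good[OF f uvV(2)] uv no_loop by blast
      then show ?thesis
        using zf_only uv 1 by metis
    next
      case 2
      then obtain i where "i < s" "u = f i"
        using in_good[OF f uvV(1)] by blast
      then show ?thesis
        using fz_only uv 2 by metis
    next
      case 3
      then obtain i j where ij: "i < s" "j < s" "u = f i" "v = f j"
        using in_good[OF f] uvV by metis
      then have "v = f (Suc i)"
        using chordless[OF cyc] uv cycle_mod[OF cyc] by metis
      with ij show ?thesis by blast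
    qed
  next
    assume ?R
    then show "(u, v) \<in> E"
      using fz zf cycle_arc[OF cyc] by blast
  qed
  obtain m where m: "s = Suc m"
    using n by (cases s) auto
  let ?C = "(\<lambda>k. (f k, f (Suc k))) ` {..<m}"
  have E: "E = insert (f m, f 0) ?C \<union> {(f m, z), (z, f 0)} \<union>
      ({(f (m - 1), z), (z, f 1)} \<inter> E)" (is "E = ?E")
  proof (intro equalityI subsetI)
    fix e
    assume e: "e \<in> E"
    obtain u v where uv: "e = (u, v)"
      by (rule prod.exhaust)
    from e consider k where "k < s" "u = f k" "v = f (Suc k)" | "e \<in> {(f m, z), (z, f 0)}"
      | "e \<in> {(f (m - 1), z), (z, f 1)}"
      using arcs[of u v] m unfolding uv by auto
    then show "e \<in> ?E"
    proof cases
      case 1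
      then show ?thesis
        using fs m uv by (cases "k = m") auto
    qed (use e in auto)
  next
    fix e
    assume "e \<in> ?E"
    then show "e \<in> E"
      using fz zf m fs cycle_arc[OF cyc, of m] cycle_arc[OF cyc] by auto
  qed
  show ?thesis
  proof (cases "(f (s - 2), z) \<in> E")
    case False
    \<comment> \<open>Here \<open>z\<close> is numbered last: the cycle \<open>f\<close> becomes
      \<open>1, ..., n - 1\<close>, and a possible arc from \<open>z\<close> to \<open>f 1\<close>
      becomes \<open>(n, 2)\<close>.\<close>
    define h where "h i = (if i = n then z else f (i - 1))" for i
    have h: "inj_on h {1..n}" "h ` {1..n} \<subseteq> V"
      using inj zC n V unfolding h_def inj_on_def by auto
    have "map_prod h h ` (\<lambda>k. (Suc k, Suc (Suc k))) ` {..<m} = ?C"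
      unfolding image_image using n(1) m by (intro image_cong) (auto simp: h_def)
    then have D1: "map_prod h h ` parcs (D1 n) = insert (f m, f 0) ?C \<union> {(f m, z), (z, f 0)}"
      using n(1) m by (auto simp: parcs_D1 lessThan_Suc image_Un h_def)
    show ?thesis
    proof (cases "(z, f 1) \<in> E")
      case True
      have "map_prod h h ` parcs (D2 n) = insert (z, f 1) (map_prod h h ` parcs (D1 n))"
        using n by (simp add: D2_def h_def)
      then have "E = map_prod h h ` parcs (D2 n)"
        unfolding D1 using E True False m by auto
      then have "labelling h (D2 n)"
        using h by (intro labellingI) (auto simp: D1_def D2_def)
      then show ?thesis by blast
    next
      case no_zf: False
      then have "E = map_prod h h ` parcs (D1 n)"
        unfolding D1 using E False m by auto
      then have "labelling h (D1 n)"
        using h by (intro labellingI) (auto simp: D1_def)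
      then show ?thesis by blast
    qed
  next
    case True
    \<comment> \<open>Now \<open>z\<close> is numbered first: the cycle \<open>f\<close> becomes
      \<open>2, ..., n\<close> with closing arc \<open>(n, 2)\<close>, and the extra arc from
      \<open>f (s - 2)\<close> to \<open>z\<close> becomes \<open>(n - 1, 1)\<close>.\<close>
    define h where "h i = (if i = 1 then z else f (i - 2))" for i
    have "inj_on h {1..n}"
    proof (rule inj_onI)
      fix i j
      assume ij: "i \<in> {1..n}" "j \<in> {1..n}" "h i = h j"
      then have "i = 1 \<longleftrightarrow> j = 1"
        using zC by (auto simp: h_def split: if_splits)
      moreover have "i - 2 < s" "j - 2 < s"
        using ij(1,2) n by auto
      then have "i - 2 = j - 2" if "i \<noteq> 1" "j \<noteq> 1"
        using inj[of "i - 2" "j - 2"] ij(3) that by (simp add: h_def)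
      ultimately show "i = j"
        using ij(1,2) by (cases "i = 1") auto
    qed
    moreover have "h ` {1..n} \<subseteq> V"
      using V by (auto simp: h_def)
    moreover have "E = map_prod h h ` parcs (D2 n)"
    proof -
      have "map_prod h h ` (\<lambda>k. (Suc k, Suc (Suc k))) ` Suc ` {..<m} = ?C"
        unfolding image_image by (intro image_cong) (auto simp: h_def)
      then have "map_prod h h ` parcs (D2 n) =
          insert (f m, f 0) ?C \<union> {(f m, z), (z, f 0), (f (m - 1), z)}"
        using n m by (auto simp: D2_def parcs_D1 lessThan_Suc_eq_insert_0 image_Un h_def numeral_2_eq_2)
      then show ?thesis
        using E True not_both m by auto
    qed
    ultimately have "labelling h (D2 n)"
      by (intro labellingI) (auto simp: D1_def D2_def)
    then show ?thesis by blast
  qed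
qed

end

section \<open>Walks in \<open>D\<^sub>1\<close> and \<open>D\<^sub>2\<close>\<close>

text \<open>An isomorphism of general digraphs carries its own arc map, tail and head. Between pair
  digraphs tail and head are \<open>fst\<close> and \<open>snd\<close>, which forces the arc map to
  be \<open>map_prod h h\<close>.\<close>

lemma digraph_iso_pair:
  assumes "pair_wf_digraph G" "pair_wf_digraph H"
  shows "digraph_iso (with_proj G) (with_proj H) \<longleftrightarrow>
    (\<exists>h. bij_betw h (pverts H) (pverts G) \<and> parcs G = map_prod h h ` parcs H)" (is "_ \<longleftrightarrow> ?R")
proof -
  have wf: "wf_digraph (with_proj G)" "wf_digraph (with_proj H)"
    using assms by (simp_all add: wf_digraph_wp_iff)
  have "digraph_iso (with_proj G) (with_proj H) \<longleftrightarrow> digraph_iso (with_proj H) (with_proj G)"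
    using digraph_iso_swap[OF wf(1)] digraph_iso_swap[OF wf(2)] by (rule iffI)
  also have "\<dots> \<longleftrightarrow> ?R"
  proof
    assume "digraph_iso (with_proj H) (with_proj G)"
    then obtain hom where hom: "pre_digraph.digraph_isomorphism (with_proj H) hom"
      and G: "with_proj G = app_iso hom (with_proj H)"
      unfolding digraph_iso_def by blast
    have "fst = iso_tail hom" "snd = iso_head hom"
      using G by (auto simp: with_proj_def app_iso_def)
    then have "iso_arcs hom a = map_prod (iso_verts hom) (iso_verts hom) a" if "a \<in> parcs H" for a
      using hom that unfolding pre_digraph.digraph_isomorphism_def
      by (auto intro!: prod_eqI)
    then have "parcs G = map_prod (iso_verts hom) (iso_verts hom) ` parcs H"
      using G by (auto simp: with_proj_def app_iso_def image_def)
    moreover have "bij_betw (iso_verts hom) (pverts H) (pverts G)"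
      using hom G unfolding pre_digraph.digraph_isomorphism_def bij_betw_def
      by (auto simp: with_proj_def app_iso_def)
    ultimately show ?R by blast
  next
    assume ?R
    then obtain h where h: "bij_betw h (pverts H) (pverts G)" "parcs G = map_prod h h ` parcs H"
      by blast
    define hom where "hom = \<lparr>iso_verts = h, iso_arcs = map_prod h h, iso_head = snd, iso_tail = fst\<rparr>"
    have "parcs H \<subseteq> pverts H \<times> pverts H"
      using assms(2) pair_wf_digraph.wellformed' by fastforce
    then have "inj_on (map_prod h h) (parcs H)"
      using h(1) map_prod_inj_on inj_on_subset unfolding bij_betw_def by metis
    then have "pre_digraph.digraph_isomorphism (with_proj H) hom"
      unfolding pre_digraph.digraph_isomorphism_def using wf(2) h(1)
      by (auto simp: hom_def bij_betw_def)
    moreover have "with_proj G = app_iso hom (with_proj H)"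
      using h by (simp add: hom_def app_iso_def with_proj_def bij_betw_def)
    ultimately show "digraph_iso (with_proj H) (with_proj G)"
      unfolding digraph_iso_def by blast
  qed
  finally show ?thesis .
qed

lemma wf_D1: "n \<ge> 3 \<Longrightarrow> pair_wf_digraph (D1 n)"
  by unfold_locales (auto simp: D1_def)

lemma wf_D2: "n \<ge> 3 \<Longrightarrow> pair_wf_digraph (D2 n)"
  by unfold_locales (auto simp: D1_def D2_def)

section \<open>Representations of integers by \<open>n\<close> and \<open>n - 1\<close>\<close>

lemma no_representation:
  fixes x y :: nat and a b N :: int
  assumes "(N + 1) * int x + N * int y = a * N + b" "0 \<le> b" "b < N" "a < b"
  shows False
proof -
  \<comment> \<open>The number \<open>q\<close> of summands is at least \<open>x\<close>. If
    \<open>q \<le> a\<close>, then \<open>x \<ge> b > a \<ge> q\<close>; if \<open>q > a\<close>,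
    then \<open>x \<le> b - N < 0\<close>.\<close>
  define q where "q = int x + int y"
  have eq: "int x = (a - q) * N + b"
    using assms(1) by (simp add: q_def algebra_simps)
  show False
  proof (cases "q \<le> a")
    case True
    then have "0 \<le> (a - q) * N"
      using assms(2,3) by simp
    then show False
      using eq assms(4) True q_def by linarith
  next
    case False
    then have "(q - a) * N \<ge> 1 * N"
      using assms(2,3) by (intro mult_right_mono) auto
    then show False
      using eq assms(3) by (simp add: algebra_simps)
  qed
qed

text \<open>The equation reads \<open>n * (x - x') = (n - 1) * (y' - y)\<close>; by coprimality
  \<open>n - 1\<close> divides the positive number \<open>x - x'\<close>.\<close>

lemma exchange_multiple:
  fixes x y x' y' n :: nat
  assumes "n * x + (n - 1) * y = n * x' + (n - 1) * y'" "x' < x" "n > 0"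
  shows "n - 1 \<le> x"
proof -
  have "int n * (int x - int x') = int (n - 1) * (int y' - int y)"
  proof -
    have "int (n * x + (n - 1) * y) = int (n * x' + (n - 1) * y')"
      using assms(1) by simp
    then show ?thesis
      unfolding of_nat_add of_nat_mult by (simp add: right_diff_distrib)
  qed
  then have "int (n - 1) dvd int n * (int x - int x')"
    by simp
  moreover have "coprime (int (n - 1)) (int n)"
    using assms(3) coprime_Suc_right_nat[of "n - 1"] by (simp add: coprime_int_iff del: coprime_Suc_right_nat)
  ultimately have "int (n - 1) dvd int x - int x'"
    by (simp add: coprime_dvd_mult_right_iff)
  then have "int (n - 1) \<le> int x - int x'"
    using assms(2) by (intro zdvd_imp_le) auto
  then show ?thesis by linarith
qed

text \<open>Brings the outcome of \<open>labelled_ambiguous\<close> for target \<open>h n\<close>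
  into the form of \<open>no_representation\<close> with \<open>N = n - 1\<close>.\<close>

lemma int_excess:
  fixes a p n x y :: nat
  assumes "a + p = n + n * (n - 1) + n * x + (n - 1) * y" "n > 0"
  shows "((int n - 1) + 1) * int x + (int n - 1) * int y = int a + int p - int n - int n * (int n - 1)"
proof -
  have "int (a + p) = int (n + n * (n - 1) + n * x + (n - 1) * y)"
    using assms(1) by simp
  moreover have "int (n - 1) = int n - 1"
    using assms(2) by linarith
  ultimately show ?thesis
    unfolding of_nat_add of_nat_mult by simp
qed

section \<open>Closed walks of length \<open>n - 1\<close>\<close>

context primitive_nonpowerful_digraph
begin

text \<open>Rotating a cycle to start at another of its vertices permutes the arcs and so keeps the
  sign.\<close>

lemma cycle_closed_walks:
  assumes "cycle c"
  obtains W where "W \<subseteq> V" "card W = length c" "\<And>w. w \<in> W \<Longrightarrow> sw w (length c) (walk_sign S c) w"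
proof -
  obtain u where c: "awalk u c u" "distinct (tl (pawalk_verts u c))"
    using assms unfolding cycle_def by auto
  define W where "W = set (tl (pawalk_verts u c))"
  have len: "length (tl (pawalk_verts u c)) = length c"
    using length_awalk_verts[of u c] by simp
  have W: "W \<subseteq> set (pawalk_verts u c)"
  proof -
    have "set (tl xs) \<subseteq> set xs" for xs :: "'a list"
      by (cases xs) auto
    then show ?thesis
      unfolding W_def .
  qed
  have "sw w (length c) (walk_sign S c) w" if "w \<in> W" for w
  proof -
    obtain q r where qr: "c = q @ r" "awalk u q w" "awalk w r u"
      using awalk_decomp[OF c(1) subsetD[OF W \<open>w \<in> W\<close>]] by blast
    then have "awalk w (r @ q) w"
      by (intro awalk_appendI)
    moreover have "length (r @ q) = length c" "walk_sign S (r @ q) = walk_sign S c"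
      using qr(1) by (simp_all add: walk_sign_append)
    ultimately show ?thesis
      unfolding signed_walk_def by blast
  qed
  moreover have "W \<subseteq> V"
    using W c(1) by (elim awalkE') simp
  moreover have "card W = length c"
    unfolding W_def using c(2) len by (simp add: distinct_card)
  ultimately show thesis
    by (intro that)
qed

lemma obtain_short_walk:
  assumes "u \<in> V" "v \<in> V"
  obtains d where "d < n" "joined u d v"
proof -
  obtain m where "joined u m v"
    using assms by (meson obtain_uniform_length)
  then obtain p where "awalk u p v"
    unfolding signed_walk_def by blast
  then have "apath u (awalk_to_apath p) v"
    by (rule apath_awalk_to_apath)
  then have "length (awalk_to_apath p) < n" "awalk u (awalk_to_apath p) v"
    using length_apath_less by (auto intro: awalkI_apath)
  then show thesis
    by (intro that[of "length (awalk_to_apath p)"]) (auto simp: signed_walk_def)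
qed

text \<open>Two \<open>(n - 1)\<close>-cycles share a vertex \<open>w\<close>, since
  \<open>2 * (n - 1) > n\<close>. There they form a pair of length \<open>n - 1\<close>, and a path
  of fewer than \<open>n\<close> arcs continues it to \<open>v\<close>.\<close>

lemma ambiguous_if_cycle_signs_differ:
  assumes "\<not> cycles_same_sign S (n - 1)" "n \<ge> 3" "v \<in> V"
  shows "amb (2 * (n - 1)) v \<noteq> {}"
proof -
  obtain c c' where c: "cycle c" "length c = n - 1" "cycle c'" "length c' = n - 1"
    "walk_sign S c \<noteq> walk_sign S c'"
    using assms(1) unfolding cycles_same_sign_def by blast
  obtain W where W: "W \<subseteq> V" "card W = n - 1" "\<And>w. w \<in> W \<Longrightarrow> sw w (n - 1) (walk_sign S c) w"
    using cycle_closed_walks[OF c(1)] c(2) by metis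
  obtain W' where W': "W' \<subseteq> V" "card W' = n - 1" "\<And>w. w \<in> W' \<Longrightarrow> sw w (n - 1) (walk_sign S c') w"
    using cycle_closed_walks[OF c(3)] c(4) by metis
  have "W \<inter> W' \<noteq> {}"
  proof
    assume "W \<inter> W' = {}"
    then have "card (W \<union> W') = 2 * (n - 1)"
      using W W' finite_subset[OF _ finite_V] by (subst card_Un_disjoint) auto
    moreover have "card (W \<union> W') \<le> n"
      using W W' by (intro card_mono) auto
    ultimately show False
      using assms(2) by linarith
  qed
  then obtain w where w: "w \<in> W" "w \<in> W'"
    by blast
  then have "w \<in> amb (n - 1) w"
    using W(3) W'(3) c(5) unfolding amb_iff_differing by blast
  moreover obtain d where d: "d < n" "joined w d v"
    using obtain_short_walk w(1) W(1) assms(3) by blast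
  ultimately have "w \<in> amb (n - 1 + d) v"
    by (intro amb_append)
  then have "amb (n - 1 + d) v \<noteq> {}"
    by blast
  then show ?thesis
    by (rule ambiguous_nonempty_later) (use d(1) in linarith)
qed

text \<open>Each \<open>v\<close> serves as its own \<open>w\<close>, so the final walk has length
  \<open>r = 0\<close>. Differing cycle signs lower the starting length from
  \<open>(n - 1) * n\<close> to \<open>2 * (n - 1)\<close>.\<close>

lemma upper_base_le_of_closed_walks_everywhere:
  assumes "1 \<le> k" "k \<le> n" "n \<ge> 3" and closed: "\<And>v. v \<in> V \<Longrightarrow> joined v (n - 1) v"
  shows "upper_base S k \<le> (n - 1) * n + (n - 1) * (n - k)"
    and "\<not> cycles_same_sign S (n - 1) \<Longrightarrow> upper_base S k \<le> 2 * (n - 1) + (n - 1) * (n - k)"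
proof -
  have pos: "n - 1 > 0"
    using assms(3) by simp
  have ub: "upper_base S k \<le> t + (n - 1) * (n - k)" if "\<And>v. v \<in> V \<Longrightarrow> amb t v \<noteq> {}" for t
  proof -
    have "\<exists>w. joined w 0 v \<and> joined w (n - 1) w \<and> amb t w \<noteq> {}" if "v \<in> V" for v
      using that closed \<open>\<And>v. v \<in> V \<Longrightarrow> amb t v \<noteq> {}\<close> by (intro exI[of _ v] conjI) simp_all
    from upper_base_le_of_closed_walks[OF pos assms(1,2) this] show ?thesis
      by simp
  qed
  show "upper_base S k \<le> (n - 1) * n + (n - 1) * (n - k)"
    by (intro ub ambiguous_nonempty pos closed)
  assume "\<not> cycles_same_sign S (n - 1)"
  then show "upper_base S k \<le> 2 * (n - 1) + (n - 1) * (n - k)"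
    using assms(3) by (intro ub ambiguous_if_cycle_signs_differ)
qed

section \<open>Length and sign of walks relative to a Hamiltonian path
  \<open>h 1, ..., h n\<close>\<close>

context
  fixes h :: "nat \<Rightarrow> 'a"
  assumes bij: "bij_betw h {1..n} V" and n2: "n \<ge> 3"
    and spine: "\<And>i. 1 \<le> i \<Longrightarrow> i < n \<Longrightarrow> (h i, h (Suc i)) \<in> E"
begin

lemma h_inj: "i \<in> {1..n} \<Longrightarrow> j \<in> {1..n} \<Longrightarrow> h i = h j \<longleftrightarrow> i = j"
  by (rule inj_on_eq_iff[OF bij_betw_imp_inj_on[OF bij]])

lemma h_V: "i \<in> {1..n} \<Longrightarrow> h i \<in> V"
  using bij_betwE[OF bij] by blast

lemma V_h: "v \<in> V \<Longrightarrow> \<exists>i\<in>{1..n}. v = h i"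
  using bij_betw_imp_surj_on[OF bij] by blast

text \<open>The sign of the path from \<open>h 1\<close> to \<open>h i\<close>, used as a potential:
  \<open>gauge a * gauge b\<close> is the sign of the stretch between \<open>h a\<close> and
  \<open>h b\<close>.\<close>

definition gauge :: "nat \<Rightarrow> int" where
  "gauge i = (\<Prod>j\<in>{1..<i}. arc_sign S (h j, h (Suc j)))"

lemma gauge_1: "gauge (Suc 0) = 1"
  by (simp add: gauge_def)

lemma gauge_Suc: "1 \<le> i \<Longrightarrow> gauge (Suc i) = gauge i * arc_sign S (h i, h (Suc i))"
  by (simp add: gauge_def prod.atLeastLessThan_Suc)

lemma gauge_square: "i \<le> n \<Longrightarrow> gauge i * gauge i = 1"
proof (induction i)
  case (Suc i)
  show ?case
  proof (cases "i = 0")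
    case False
    then have "arc_sign S (h i, h (Suc i)) * arc_sign S (h i, h (Suc i)) = 1"
      using spine[of i] Suc.prems arc_sign_cases by fastforce
    then show ?thesis
      using Suc False gauge_Suc[of i] by (simp add: algebra_simps)
  qed (simp add: gauge_1)
qed (simp add: gauge_def)

lemma spine_joined: "1 \<le> a \<Longrightarrow> a \<le> b \<Longrightarrow> b \<le> n \<Longrightarrow> joined (h a) (b - a) (h b)"
  using spine h_V by (intro joined_along) auto

text \<open>Provides both \<open>(n - 1)\<close>-cycles of \<open>D2\<close> as arc lists, so that
  \<open>cycles_same_sign\<close> becomes an equation between gauges.\<close>

lemma spine_cycle:
  assumes "1 \<le> a" "a \<le> b" "b \<le> n" "(h b, h a) \<in> E"
  defines "p \<equiv> map (\<lambda>i. (h i, h (Suc i))) [a..<b] @ [(h b, h a)]"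
  shows "cycle p" "length p = b - a + 1"
    and "walk_sign S p = gauge a * gauge b * arc_sign S (h b, h a)"
proof -
  let ?q = "\<lambda>b. map (\<lambda>i. (h i, h (Suc i))) [a..<b]"
  have q: "awalk (h a) (?q b) (h b) \<and> walk_sign S (?q b) = gauge a * gauge b"
    if "a \<le> b" "b \<le> n" for b
    using that
  proof (induction b rule: dec_induct)
    case base
    then show ?case using assms(1) h_V gauge_square by (auto simp: awalk_Nil_iff)
  next
    case (step b)
    have "awalk (h b) [(h b, h (Suc b))] (h (Suc b))"
      using spine[of b] step assms(1) by (auto simp: awalk_simps wellformed')
    then show ?case
      using step awalk_appendI[of "h a" "?q b" "h b"] assms(1)
      by (auto simp: walk_sign_append gauge_Suc simp del: awalk_append_iff)
  qed
  have walk: "awalk (h a) p (h a)"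
    unfolding p_def using q[OF assms(2,3)] assms(4)
    by (intro awalk_appendI) (auto simp: awalk_simps wellformed')
  have "map fst p = map h [a..<Suc b]"
    using assms(2) by (simp add: p_def)
  then have "pawalk_verts (h a) p = map h [a..<Suc b] @ [h a]"
    using awalk_verts_conv[of "h a" p] by (simp add: p_def)
  then have "tl (pawalk_verts (h a) p) = map h [Suc a..<Suc b] @ [h a]"
    using assms(2) by (simp add: upt_conv_Cons del: upt_Suc)
  moreover have "distinct (map h [Suc a..<Suc b] @ [h a])"
    using assms(1-3) h_inj by (auto simp: distinct_map inj_on_def)
  ultimately show "cycle p"
    unfolding cycle_def using walk by (auto simp: p_def)
  show "length p = b - a + 1"
    by (simp add: p_def)
  show "walk_sign S p = gauge a * gauge b * arc_sign S (h b, h a)"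
    unfolding p_def using q[OF assms(2,3)] by (simp add: walk_sign_append)
qed

text \<open>
  After multiplying the sign of each arc by the gauges of its ends, the arcs \<open>(h i, h (i + 1))\<close> are
  positive, the arc closing the \<open>n\<close>-cycle has sign \<open>\<alpha>\<close>, and those closing the \<open>(n-1)\<close>-cycles have
  sign \<open>\<beta>\<close>; below, \<open>x\<close> and \<open>y\<close> count the closing arcs of the two kinds.
\<close>
lemma labelled_walk:
  defines "\<alpha> \<equiv> gauge n * arc_sign S (h n, h 1)"
    and "\<beta> \<equiv> gauge (n - 1) * arc_sign S (h (n - 1), h 1)"
  assumes arcs: "\<And>i j. i \<in> {1..n} \<Longrightarrow> j \<in> {1..n} \<Longrightarrow> (h i, h j) \<in> E \<Longrightarrow>
      j = Suc i \<or> i = n \<and> j = 1 \<or> i = n - 1 \<and> j = 1 \<or> i = n \<and> j = 2"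
    and sign: "(h n, h 2) \<in> E \<Longrightarrow> gauge 2 * gauge n * arc_sign S (h n, h 2) = \<beta>"
    and "i \<in> {1..n}" "j \<in> {1..n}" "sw (h i) t \<sigma> (h j)"
  shows "\<exists>x y. i + t = j + n * x + (n - 1) * y \<and> \<sigma> = gauge i * gauge j * \<alpha> ^ x * \<beta> ^ y"
  using assms(5,7)
proof (induction t arbitrary: i \<sigma>)
  case 0
  then have "i = j" "\<sigma> = 1"
    using h_inj assms(6) by auto
  then show ?case
    using gauge_square assms(6) by (intro exI[of _ 0]) simp
next
  case (Suc t)
  from Suc.prems(2) have "sw (h i) (1 + t) \<sigma> (h j)" by simp
  then obtain w \<sigma>1 \<sigma>2 where w: "sw (h i) 1 \<sigma>1 w" "sw w t \<sigma>2 (h j)" "\<sigma> = \<sigma>1 * \<sigma>2"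
    by (rule sw_splitE)
  then obtain l where l: "l \<in> {1..n}" "w = h l"
    using V_h sw_verts by metis
  have arc: "(h i, h l) \<in> E" "\<sigma>1 = arc_sign S (h i, h l)"
    using w(1) l(2) by (simp_all only: sw_1)
  obtain x y where xy: "l + t = j + n * x + (n - 1) * y"
    "\<sigma>2 = gauge l * gauge j * \<alpha> ^ x * \<beta> ^ y"
    using Suc.IH[OF l(1)] w(2) l(2) by blast
  have sq: "gauge l * gauge l = 1" "gauge i * gauge i = 1"
    using gauge_square l(1) Suc.prems(1) by auto
  \<comment> \<open>The factors \<open>gauge l\<close> cancel where the first arc meets the rest, so
    a first arc of gauged sign \<open>\<alpha> ^ x0 * \<beta> ^ y0\<close> only adds to the
    exponents.\<close>
  have sigma: "\<sigma> = gauge i * gauge j * \<alpha> ^ (x0 + x) * \<beta> ^ (y0 + y)"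
    if "gauge i * gauge l * arc_sign S (h i, h l) = \<alpha> ^ x0 * \<beta> ^ y0" for x0 y0
  proof -
    have "\<sigma> = (gauge i * gauge i) * arc_sign S (h i, h l) * (gauge l * gauge j * \<alpha> ^ x * \<beta> ^ y)"
      using w(3) arc(2) xy(2) sq(2) by simp
    also have "\<dots> = gauge i * (gauge i * gauge l * arc_sign S (h i, h l)) * gauge j * \<alpha> ^ x * \<beta> ^ y"
      by (simp only: ac_simps)
    also have "\<dots> = gauge i * gauge j * \<alpha> ^ (x0 + x) * \<beta> ^ (y0 + y)"
      unfolding that by (simp add: power_add ac_simps)
    finally show ?thesis .
  qed
  \<comment> \<open>A spine arc raises the label by 1 per step. Relative to that,
    \<open>(n, 1)\<close> loses \<open>n\<close>, while \<open>(n - 1, 1)\<close> and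
    \<open>(n, 2)\<close> both lose \<open>n - 1\<close>.\<close>
  consider "l = Suc i" | "i = n" "l = 1" | "i = n - 1" "l = 1" | "i = n" "l = 2"
    using arcs[OF Suc.prems(1) l(1) arc(1)] by blast
  then show ?case
  proof cases
    case 1
    then have "gauge i * gauge l * arc_sign S (h i, h l) = \<alpha> ^ 0 * \<beta> ^ 0"
      using gauge_Suc[of i] Suc.prems(1) sq by (simp add: algebra_simps)
    from sigma[OF this] show ?thesis
      using xy(1) 1 by (intro exI[of _ x] exI[of _ y]) simp
  next
    case 2
    then have "gauge i * gauge l * arc_sign S (h i, h l) = \<alpha> ^ 1 * \<beta> ^ 0"
      using gauge_1 by (simp add: \<alpha>_def)
    from sigma[OF this] show ?thesis
      using xy(1) 2 by (intro exI[of _ "1 + x"] exI[of _ y]) simp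
  next
    case 3
    then have "gauge i * gauge l * arc_sign S (h i, h l) = \<alpha> ^ 0 * \<beta> ^ 1"
      using gauge_1 by (simp add: \<beta>_def)
    from sigma[OF this] show ?thesis
      using xy(1) 3 n2 by (intro exI[of _ x] exI[of _ "1 + y"]) simp
  next
    case 4
    then have "gauge i * gauge l * arc_sign S (h i, h l) = \<alpha> ^ 0 * \<beta> ^ 1"
      using sign arc(1) by (simp add: ac_simps)
    from sigma[OF this] show ?thesis
      using xy(1) 4 n2 by (intro exI[of _ x] exI[of _ "1 + y"]) simp
  qed
qed

text \<open>Two signs need two representations of the same length with different \<open>x\<close>.
  The larger \<open>x\<close> is then at least \<open>n - 1\<close>, which splits off
  \<open>n * (n - 1)\<close>.\<close>

lemma labelled_ambiguous:
  assumes arcs: "\<And>i j. i \<in> {1..n} \<Longrightarrow> j \<in> {1..n} \<Longrightarrow> (h i, h j) \<in> E \<Longrightarrow>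
      j = Suc i \<or> i = n \<and> j = 1 \<or> i = n - 1 \<and> j = 1 \<or> i = n \<and> j = 2"
    and sign: "(h n, h 2) \<in> E \<Longrightarrow> gauge 2 * gauge n * arc_sign S (h n, h 2) =
      gauge (n - 1) * arc_sign S (h (n - 1), h 1)"
    and "i \<in> {1..n}" "j \<in> {1..n}" "h i \<in> amb t (h j)"
  shows "\<exists>x y. i + t = j + n * (n - 1) + n * x + (n - 1) * y"
proof -
  let ?\<alpha> = "gauge n * arc_sign S (h n, h 1)"
    and ?\<beta> = "gauge (n - 1) * arc_sign S (h (n - 1), h 1)"
  have walks: "\<exists>x y. i + t = j + n * x + (n - 1) * y \<and> \<sigma> = gauge i * gauge j * ?\<alpha> ^ x * ?\<beta> ^ y"
    if "sw (h i) t \<sigma> (h j)" for \<sigma>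
    using arcs sign assms(3,4) that by (rule labelled_walk)
  have larger: "?thesis" if "i + t = j + n * x + (n - 1) * y" "i + t = j + n * x' + (n - 1) * y'" "x' < x"
    for x y x' y'
  proof -
    have "n - 1 \<le> x"
      using that n2 by (intro exchange_multiple[of n x y x' y']) auto
    then obtain d where "x = n - 1 + d"
      using le_Suc_ex by blast
    then show ?thesis
      using that(1) by (intro exI[of _ d] exI[of _ y]) (simp add: add_mult_distrib2)
  qed
  obtain \<sigma> \<tau> where "sw (h i) t \<sigma> (h j)" "sw (h i) t \<tau> (h j)" "\<sigma> \<noteq> \<tau>"
    using assms(5) unfolding amb_iff_differing by blast
  then obtain x y x' y' where xy: "i + t = j + n * x + (n - 1) * y"
      "\<sigma> = gauge i * gauge j * ?\<alpha> ^ x * ?\<beta> ^ y" "i + t = j + n * x' + (n - 1) * y'"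
      "\<tau> = gauge i * gauge j * ?\<alpha> ^ x' * ?\<beta> ^ y'"
    using walks by metis
  have "x \<noteq> x'"
  proof
    assume "x = x'"
    then have "(n - 1) * y = (n - 1) * y'"
      using xy(1,3) unfolding \<open>x = x'\<close> by linarith
    moreover have "n - 1 > 0"
      using n2 by simp
    ultimately have "y = y'"
      by (simp only: mult_cancel1) simp
    then show False
      using xy(2,4) \<open>x = x'\<close> \<open>\<sigma> \<noteq> \<tau>\<close> by simp
  qed
  then consider "x' < x" | "x < x'" by linarith
  then show ?thesis
    using larger[OF xy(1,3)] larger[OF xy(3,1)] by cases
qed

end

section \<open>Extremal sets in \<open>D1\<close> and \<open>D2\<close>\<close>

lemma labelling_D1:
  assumes "labelling h (D1 n)" "n \<ge> 3"
  shows "bij_betw h {1..n} V" "\<And>i. 1 \<le> i \<Longrightarrow> i < n \<Longrightarrow> (h i, h (Suc i)) \<in> E"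
    and "i \<in> {1..n} \<Longrightarrow> j \<in> {1..n} \<Longrightarrow> (h i, h j) \<in> E \<Longrightarrow>
      j = Suc i \<or> i = n \<and> j = 1 \<or> i = n - 1 \<and> j = 1"
proof -
  show bij: "bij_betw h {1..n} V"
    using assms(1) by (simp add: labelling_def D1_def)
  have E: "E = map_prod h h ` parcs (D1 n)"
    using assms(1) by (simp add: labelling_def)
  show "(h i, h (Suc i)) \<in> E" if "1 \<le> i" "i < n" for i
    unfolding E D1_def using that by auto
  assume ij: "i \<in> {1..n}" "j \<in> {1..n}" "(h i, h j) \<in> E"
  then obtain i' j' where "(i', j') \<in> parcs (D1 n)" "h i = h i'" "h j = h j'"
    unfolding E by auto
  moreover from this have "i' \<in> {1..n}" "j' \<in> {1..n}"
    using assms(2) by (auto simp: D1_def)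
  ultimately have "(i, j) \<in> parcs (D1 n)"
    using inj_on_eq_iff[OF bij_betw_imp_inj_on[OF bij]] ij(1,2) by simp
  then show "j = Suc i \<or> i = n \<and> j = 1 \<or> i = n - 1 \<and> j = 1"
    by (auto simp: D1_def)
qed

lemma labelling_D2:
  assumes "labelling h (D2 n)" "n \<ge> 3"
  shows "bij_betw h {1..n} V" "\<And>i. 1 \<le> i \<Longrightarrow> i < n \<Longrightarrow> (h i, h (Suc i)) \<in> E"
    and "(h (n - 1), h 1) \<in> E" "(h n, h 2) \<in> E"
    and "i \<in> {1..n} \<Longrightarrow> j \<in> {1..n} \<Longrightarrow> (h i, h j) \<in> E \<Longrightarrow>
      j = Suc i \<or> i = n \<and> j = 1 \<or> i = n - 1 \<and> j = 1 \<or> i = n \<and> j = 2"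
proof -
  show bij: "bij_betw h {1..n} V"
    using assms(1) by (simp add: labelling_def D1_def D2_def)
  have E: "E = map_prod h h ` parcs (D2 n)"
    using assms(1) by (simp add: labelling_def)
  show "(h i, h (Suc i)) \<in> E" if "1 \<le> i" "i < n" for i
    unfolding E D1_def D2_def using that by auto
  show "(h (n - 1), h 1) \<in> E" "(h n, h 2) \<in> E"
    unfolding E D1_def D2_def by auto
  assume ij: "i \<in> {1..n}" "j \<in> {1..n}" "(h i, h j) \<in> E"
  then obtain i' j' where "(i', j') \<in> parcs (D2 n)" "h i = h i'" "h j = h j'"
    unfolding E by auto
  moreover from this have "i' \<in> {1..n}" "j' \<in> {1..n}"
    using assms(2) by (auto simp: D1_def D2_def)
  ultimately have "(i, j) \<in> parcs (D2 n)"
    using inj_on_eq_iff[OF bij_betw_imp_inj_on[OF bij]] ij(1,2) by simp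
  then show "j = Suc i \<or> i = n \<and> j = 1 \<or> i = n - 1 \<and> j = 1 \<or> i = n \<and> j = 2"
    by (auto simp: D1_def D2_def)
qed

text \<open>The last \<open>k\<close> vertices have no pair of length \<open>p\<close> to
  \<open>h n\<close>: from \<open>h i\<close> the excess is
  \<open>(n - k - 1) * (n - 1) + (i - 1)\<close>, not representable for
  \<open>n - k < i < n\<close>. For \<open>i = n\<close> the remainder is too large, and the first
  arc is removed.\<close>

lemma D1_lower:
  assumes "labelling h (D1 n)" "n \<ge> 3" "1 \<le> k" "k \<le> n"
  shows "(2 * n - k) * (n - 1) < upper_base S k"
proof -
  note D = labelling_D1[OF assms(1,2)]
  define p where "p = (2 * n - k) * (n - 1)"
  obtain p' where p': "p = Suc p'"
    using assms(2-4) by (cases p) (auto simp: p_def)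
  have p_int: "int p = (2 * int n - int k) * (int n - 1)"
    using assms by (simp add: p_def of_nat_diff)
  have no_arc: "(h n, h 2) \<notin> E"
    using D(3)[of n 2] assms(2) by auto
  have amb: "\<exists>x y. i + t = n + n * (n - 1) + n * x + (n - 1) * y"
    if "i \<in> {1..n}" "h i \<in> amb t (h n)" for i t
    using D no_arc assms(2) that by (intro labelled_ambiguous[of h]) auto
  have low: False if i: "n - k + 1 \<le> i" "i < n" "h i \<in> amb p (h n)" for i
  proof -
    obtain x y where "i + p = n + n * (n - 1) + n * x + (n - 1) * y"
      using amb[of i p] i by auto
    from int_excess[OF this n_pos]
    have eq: "((int n - 1) + 1) * int x + (int n - 1) * int y = (int n - int k - 1) * (int n - 1) + (int i - 1)"
      unfolding p_int by (simp add: algebra_simps)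
    show False
      using i assms(2-4) by (intro no_representation[OF eq]) auto
  qed
  have top: False if "h n \<in> amb p (h n)"
  proof -
    \<comment> \<open>\<open>h 1\<close> is the only successor of \<open>h n\<close>; without this step the counting argument would allow
      the pair.\<close>
    obtain \<sigma> \<tau> where st: "sw (h n) (1 + p') \<sigma> (h n)" "sw (h n) (1 + p') \<tau> (h n)" "\<sigma> \<noteq> \<tau>"
      using \<open>h n \<in> amb p (h n)\<close> unfolding p' plus_1_eq_Suc amb_iff_differing by blast
    have first: "\<exists>\<rho>'. sw (h 1) p' \<rho>' (h n) \<and> \<rho> = arc_sign S (h n, h 1) * \<rho>'"
      if "sw (h n) (1 + p') \<rho> (h n)" for \<rho>
    proof -
      obtain w \<rho>1 \<rho>2 where w: "sw (h n) 1 \<rho>1 w" "sw w p' \<rho>2 (h n)" "\<rho> = \<rho>1 * \<rho>2"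
        using \<open>sw (h n) (1 + p') \<rho> (h n)\<close> by (rule sw_splitE)
      then have arc: "(h n, w) \<in> E" "\<rho>1 = arc_sign S (h n, w)"
        by (simp_all only: sw_1)
      then obtain l where "l \<in> {1..n}" "w = h l"
        using bij_betw_imp_surj_on[OF D(1)] wellformed'(2) by blast
      then have "w = h 1"
        using D(3)[of n l] arc(1) assms(2) by auto
      then show ?thesis
        using w arc(2) by blast
    qed
    have "h 1 \<in> amb p' (h n)"
      using first[OF st(1)] first[OF st(2)] st(3) unfolding amb_iff_differing by blast
    then obtain x y where "1 + p' = n + n * (n - 1) + n * x + (n - 1) * y"
      using amb[of 1 p'] assms(2) by auto
    \<comment> \<open>A walk of length \<open>p'\<close> from label 1 counts like one of length
      \<open>p\<close> from label 0, which brings the remainder down to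
      \<open>n - 2\<close>.\<close>
    then have "0 + p = n + n * (n - 1) + n * x + (n - 1) * y"
      using p' by simp
    from int_excess[OF this n_pos]
    have eq: "((int n - 1) + 1) * int x + (int n - 1) * int y = (int n - int k - 2) * (int n - 1) + (int n - 2)"
      unfolding p_int by (simp add: algebra_simps)
    show False
      using assms(2-4) by (intro no_representation[OF eq]) auto
  qed
  have "p < upper_base S k"
  proof (rule upper_base_greater[OF assms(3)])
    show "h ` {n - k + 1..n} \<subseteq> V" "h n \<in> V"
      using bij_betwE[OF D(1)] assms(2) by auto
    have "inj_on h {n - k + 1..n}"
      by (rule inj_on_subset[OF bij_betw_imp_inj_on[OF D(1)]]) auto
    then show "card (h ` {n - k + 1..n}) = k"
      using assms(4) by (simp add: card_image)
    show "h ` {n - k + 1..n} \<inter> amb p (h n) = {}"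
    proof (intro equals0I)
      fix u
      assume "u \<in> h ` {n - k + 1..n} \<inter> amb p (h n)"
      then obtain i where "n - k + 1 \<le> i" "i \<le> n" "h i \<in> amb p (h n)"
        by auto
      then show False
        using low[of i] top by (cases "i = n") auto
    qed
  qed
  then show ?thesis
    by (simp add: p_def)
qed

text \<open>At one step less than the claimed value the excess is
  \<open>(n - k - 1) * (n - 1) + (i - 2)\<close>, which excludes labels from
  \<open>n - k + 2\<close> to \<open>n\<close>. Label 1 completes the \<open>k\<close>-set: its
  remainder -1 borrows one \<open>n - 1\<close> and becomes \<open>n - 2\<close>.\<close>

lemma D2_lower:
  assumes "labelling h (D2 n)" "n \<ge> 3" "1 \<le> k" "k \<le> n" "cycles_same_sign S (n - 1)"
  shows "(2 * n - k) * (n - 1) \<le> upper_base S k"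
proof -
  note D = labelling_D2[OF assms(1,2)]
  define p where "p = (2 * n - k) * (n - 1) - 1"
  have "(2 * n - k) * (n - 1) \<ge> 1"
    using assms(2-4) by (simp add: Suc_le_eq)
  then have p_Suc: "Suc p = (2 * n - k) * (n - 1)"
    unfolding p_def by linarith
  have "int (Suc p) = (2 * int n - int k) * (int n - 1)"
    unfolding p_Suc using assms by (simp add: of_nat_diff)
  then have p_int: "int p = (2 * int n - int k) * (int n - 1) - 1"
    by simp
  let ?p1 = "map (\<lambda>i. (h i, h (Suc i))) [1..<n - 1] @ [(h (n - 1), h 1)]"
  let ?p2 = "map (\<lambda>i. (h i, h (Suc i))) [2..<n] @ [(h n, h 2)]"
  have c1: "cycle ?p1" "length ?p1 = n - 1 - 1 + 1"
    "walk_sign S ?p1 = gauge h 1 * gauge h (n - 1) * arc_sign S (h (n - 1), h 1)"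
    using assms(2) D by (intro spine_cycle[of h]; simp)+
  have c2: "cycle ?p2" "length ?p2 = n - 2 + 1"
    "walk_sign S ?p2 = gauge h 2 * gauge h n * arc_sign S (h n, h 2)"
    using assms(2) D by (intro spine_cycle[of h]; simp)+
  have "walk_sign S ?p1 = walk_sign S ?p2"
  proof -
    have "length ?p1 = n - 1" "length ?p2 = n - 1"
      using assms(2) unfolding c1(2) c2(2) by auto
    then show ?thesis
      using assms(5) c1(1) c2(1) unfolding cycles_same_sign_def by blast
  qed
  then have sign: "gauge h 2 * gauge h n * arc_sign S (h n, h 2) =
      gauge h (n - 1) * arc_sign S (h (n - 1), h 1)"
    using c1(3) c2(3) gauge_1[OF D(1) assms(2) D(2)] by simp
  have low: False if i: "i \<in> {1..n}" "i = 1 \<or> n - k + 2 \<le> i" "h i \<in> amb p (h n)" for i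
  proof -
    have "\<exists>x y. i + p = n + n * (n - 1) + n * x + (n - 1) * y"
      using D sign assms(2) i by (intro labelled_ambiguous[of h]) auto
    then obtain x y where "i + p = n + n * (n - 1) + n * x + (n - 1) * y"
      by blast
    from int_excess[OF this n_pos]
    have eq: "((int n - 1) + 1) * int x + (int n - 1) * int y = (int n - int k - 1) * (int n - 1) + (int i - 2)"
      unfolding p_int by (simp add: algebra_simps)
    show False
    proof (cases "i = 1")
      case True
      then have eq': "((int n - 1) + 1) * int x + (int n - 1) * int y = (int n - int k - 2) * (int n - 1) + (int n - 2)"
        using eq by (simp add: algebra_simps)
      show False
        using assms(2-4) by (intro no_representation[OF eq']) auto
    next
      case False
      then show False
        using i(1,2) assms(2-4) by (intro no_representation[OF eq]) auto
    qed
  qed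
  define J where "J = insert 1 {n - k + 2..n}"
  have I: "J \<subseteq> {1..n}" "card J = k"
    using assms(2-4) by (auto simp: J_def)
  have "p < upper_base S k"
  proof (rule upper_base_greater[OF assms(3)])
    show "h ` J \<subseteq> V" "h n \<in> V"
      using bij_betwE[OF D(1)] I(1) assms(2) by auto
    have "inj_on h J"
      by (rule inj_on_subset[OF bij_betw_imp_inj_on[OF D(1)] I(1)])
    then show "card (h ` J) = k"
      using I(2) by (simp add: card_image)
    show "h ` J \<inter> amb p (h n) = {}"
    proof (intro equals0I)
      fix u
      assume "u \<in> h ` J \<inter> amb p (h n)"
      then obtain i where i: "i \<in> J" "h i \<in> amb p (h n)"
        by auto
      from i(1) show False
        using low[OF subsetD[OF I(1) i(1)] _ i(2)] by (auto simp: J_def)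
    qed
  qed
  then show ?thesis
    using p_Suc by simp
qed

text \<open>The cycle on \<open>1, ..., n - 1\<close> misses only \<open>h n\<close>, which lies on
  the cycle on \<open>2, ..., n\<close>.\<close>

lemma D2_closed_walks:
  assumes "labelling h (D2 n)" "n \<ge> 3" "v \<in> V"
  shows "joined v (n - 1) v"
proof -
  note D = labelling_D2[OF assms(1,2)]
  have path: "joined (h a) (b - a) (h b)" if "1 \<le> a" "a \<le> b" "b \<le> n" for a b
    using D that assms(2) by (intro spine_joined) auto
  obtain i where i: "i \<in> {1..n}" "v = h i"
    using bij_betw_imp_surj_on[OF D(1)] assms(3) by blast
  show ?thesis
  proof (cases "i = n")
    case True
    have "joined (h n) (1 + (n - 2)) (h n)"
      using D(4) path[of 2 n] assms(2) by (intro joined_append[of _ 1 "h 2"]) (auto simp only: joined_1)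
    moreover have "1 + (n - 2) = n - 1"
      using assms(2) by simp
    ultimately show ?thesis
      unfolding i(2) True by (simp only:)
  next
    case False
    then have "joined (h i) (n - 1 - i) (h (n - 1))" "joined (h 1) (i - 1) (h i)"
      using path[of i "n - 1"] path[of 1 i] i(1) by auto
    moreover have "joined (h (n - 1)) 1 (h 1)"
      unfolding joined_1 by (rule D(3))
    ultimately have "joined (h i) (n - 1 - i + 1 + (i - 1)) (h i)"
      by (blast intro: joined_append)
    moreover have "n - 1 - i + 1 + (i - 1) = n - 1"
      using False i(1) by auto
    ultimately show ?thesis
      unfolding i(2) by (simp only:)
  qed
qed

section \<open>The values of the upper base\<close>

text \<open>The girth bound \<open>s * (2n - k - 1) + n\<close> increases with \<open>s\<close> and
  equals \<open>M + 1\<close> at \<open>s = n - 1\<close>. Integers avoid truncated subtraction in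
  \<open>M - 3\<close>.\<close>

lemma upper_base_cases:
  assumes "n \<ge> 6" "1 \<le> k" "k \<le> n"
  defines "M \<equiv> (2 * int n - int k) * (int n - 1)"
  shows "int (upper_base S k) \<le> M + 1"
    and "(\<exists>h. labelling h (D1 n)) \<Longrightarrow> int (upper_base S k) = M + 1"
    and "(\<exists>h. labelling h (D2 n)) \<Longrightarrow> cycles_same_sign S (n - 1) \<Longrightarrow> int (upper_base S k) = M"
    and "(\<exists>h. labelling h (D1 n)) \<or> (\<exists>h. labelling h (D2 n)) \<and> cycles_same_sign S (n - 1) \<or>
      int (upper_base S k) \<le> M - 3"
proof -
  have M: "int ((2 * n - k) * (n - 1)) = M"
    unfolding M_def using assms(1-3) by (simp add: of_nat_diff)
  \<comment> \<open>This product is the exact amount by which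
    \<open>2 * (n - 1) + (n - 1) * (n - k)\<close>, the bound for differing cycle signs, stays below
    \<open>M\<close>.\<close>
  have slack: "(int n - 2) * (int n - 1) \<ge> 4 * 1"
    using assms(1) by (intro mult_mono) auto
  obtain s f where cyc: "shortest_cycle s f"
    by (rule obtain_shortest_cycle)
  have s: "s < n"
    using girth_less[OF cyc] assms(1) by simp
  have "upper_base S k \<le> s * n + s * (n - k) + (n - s)"
    by (rule upper_base_le_girth[OF cyc assms(2,3)])
  then have "int (upper_base S k) \<le> int (s * n + s * (n - k) + (n - s))"
    by (rule of_nat_mono)
  also have "\<dots> = int s * int n + int s * (int n - int k) + (int n - int s)"
    using s assms(3) by (simp add: of_nat_diff)
  finally have ub: "int (upper_base S k) \<le> int s * (2 * int n - int k - 1) + int n"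
    by (simp add: algebra_simps)
  have bound: "int (upper_base S k) \<le> r * (2 * int n - int k - 1) + int n" if "int s \<le> r" for r
  proof -
    have "int s * (2 * int n - int k - 1) \<le> r * (2 * int n - int k - 1)"
      using that assms by (intro mult_right_mono) auto
    with ub show ?thesis by linarith
  qed
  show le: "int (upper_base S k) \<le> M + 1"
    using bound[of "int n - 1"] s by (simp add: M_def algebra_simps)
  show "int (upper_base S k) = M + 1" if "\<exists>h. labelling h (D1 n)"
  proof -
    have "(2 * n - k) * (n - 1) < upper_base S k"
      using that D1_lower assms(1-3) by auto
    then have "M < int (upper_base S k)"
      unfolding M[symmetric] by (rule of_nat_less_iff[THEN iffD2])
    with le show ?thesis by linarith
  qed
  have D2_le: "int (upper_base S k) \<le> M" "\<not> cycles_same_sign S (n - 1) \<Longrightarrow> int (upper_base S k) \<le> M - 3"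
    if "\<exists>h. labelling h (D2 n)"
  proof -
    have closed: "joined v (n - 1) v" if "v \<in> V" for v
      using \<open>\<exists>h. labelling h (D2 n)\<close> D2_closed_walks that assms(1) by auto
    have "n \<ge> 3"
      using assms(1) by simp
    note ub = upper_base_le_of_closed_walks_everywhere[OF assms(2,3) this closed]
    have "int (upper_base S k) \<le> int ((n - 1) * n + (n - 1) * (n - k))"
      using ub(1) by (rule of_nat_mono)
    also have "\<dots> = (int n - 1) * int n + (int n - 1) * (int n - int k)"
      using assms(1,3) by (simp add: of_nat_diff)
    finally show "int (upper_base S k) \<le> M"
      by (simp add: M_def algebra_simps)
    assume "\<not> cycles_same_sign S (n - 1)"
    then have "int (upper_base S k) \<le> int (2 * (n - 1) + (n - 1) * (n - k))"
      using ub(2) by (intro of_nat_mono)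
    also have "\<dots> = 2 * (int n - 1) + (int n - 1) * (int n - int k)"
      using assms(1,3) by (simp add: of_nat_diff)
    finally show "int (upper_base S k) \<le> M - 3"
      using slack by (simp add: M_def algebra_simps)
  qed
  show "int (upper_base S k) = M" if "\<exists>h. labelling h (D2 n)" "cycles_same_sign S (n - 1)"
  proof -
    have "(2 * n - k) * (n - 1) \<le> upper_base S k"
      using that D2_lower assms(1-3) by auto
    then have "M \<le> int (upper_base S k)"
      unfolding M[symmetric] by (rule of_nat_mono)
    with D2_le(1)[OF that(1)] show ?thesis by linarith
  qed
  show "(\<exists>h. labelling h (D1 n)) \<or> (\<exists>h. labelling h (D2 n)) \<and> cycles_same_sign S (n - 1) \<or>
      int (upper_base S k) \<le> M - 3"
  proof (cases "s = n - 1")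
    case True
    then have "(\<exists>h. labelling h (D1 n)) \<or> (\<exists>h. labelling h (D2 n))"
      using girth_pred_order[OF cyc] assms(1) by fastforce
    then show ?thesis
      using D2_le(2) by blast
  next
    case False
    then have "int (upper_base S k) \<le> (int n - 2) * (2 * int n - int k - 1) + int n"
      using bound[of "int n - 2"] s by simp
    \<comment> \<open>From \<open>k \<le> n\<close> and \<open>n \<ge> 6\<close> at least 6 is
      subtracted, so the value is at most \<open>M - 4\<close>.\<close>
    also have "\<dots> = M + 2 - (2 * int n - int k)"
      by (simp add: M_def algebra_simps)
    finally show ?thesis
      using assms(1,3) by linarith
  qed
qed

end

theorem theorem3p7:
  fixes n k :: nat
  assumes "n \<ge> 6" and "1 \<le> k" and "k \<le> n"
  shows "(\<forall>S :: 'a pre_signed_digraph. primitive_nonpowerful S \<and> order S = n \<longrightarrow>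
            int (upper_base S k) \<le> (2 * int n - int k) * (int n - 1) + 1 \<and>
            (int (upper_base S k) = (2 * int n - int k) * (int n - 1) + 1 \<longleftrightarrow>
               digraph_iso (with_proj (underlying S)) (with_proj (D1 n))) \<and>
            (int (upper_base S k) = (2 * int n - int k) * (int n - 1) \<longleftrightarrow>
               digraph_iso (with_proj (underlying S)) (with_proj (D2 n)) \<and>
               cycles_same_sign S (n - 1)))
       \<and> (\<forall>t :: int. (2 * int n - int k) * (int n - 1) - 3 < t \<and>
                     t < (2 * int n - int k) * (int n - 1) \<longrightarrow>
            \<not> (\<exists>S :: 'a pre_signed_digraph. primitive_nonpowerful S \<and> order S = n \<and>
                 int (upper_base S k) = t))"
proof -
  let ?M = "(2 * int n - int k) * (int n - 1)"
  have main: "int (upper_base S k) \<le> ?M + 1"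
    "int (upper_base S k) = ?M + 1 \<longleftrightarrow> digraph_iso (with_proj (underlying S)) (with_proj (D1 n))"
    "int (upper_base S k) = ?M \<longleftrightarrow>
       digraph_iso (with_proj (underlying S)) (with_proj (D2 n)) \<and> cycles_same_sign S (n - 1)"
    "int (upper_base S k) \<le> ?M - 3 \<or> ?M \<le> int (upper_base S k)"
    if S: "primitive_nonpowerful S" "order S = n" for S :: "'a pre_signed_digraph"
  proof -
    interpret signed_digraph S
      using S(1) by (simp add: primitive_nonpowerful_def)
    interpret primitive_nonpowerful_digraph S
      by unfold_locales (use S(1) in \<open>auto simp: primitive_nonpowerful_def\<close>)
    have n: "card (pverts (underlying S)) = n"
      using S(2) by (simp add: order_def)
    have "pair_wf_digraph (underlying S)"
      by unfold_locales
    then have iso: "digraph_iso (with_proj (underlying S)) (with_proj (D1 n)) \<longleftrightarrow> (\<exists>h. labelling h (D1 n))"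
      "digraph_iso (with_proj (underlying S)) (with_proj (D2 n)) \<longleftrightarrow> (\<exists>h. labelling h (D2 n))"
      using digraph_iso_pair wf_D1[of n] wf_D2[of n] assms(1) by (simp_all add: labelling_def)
    note T = upper_base_cases[of k, unfolded n, OF assms]
    let ?D1 = "\<exists>h. labelling h (D1 n)" and ?D2 = "\<exists>h. labelling h (D2 n)"
    show "int (upper_base S k) \<le> ?M + 1"
      by (rule T(1))
    \<comment> \<open>The values \<open>M + 1\<close>, \<open>M\<close> and at most
      \<open>M - 3\<close> exclude one another, which turns the implications in \<open>T\<close>
      into equivalences.\<close>
    from T(4) consider "?D1" | "?D2" "cycles_same_sign S (n - 1)"
      | "\<not> ?D1" "\<not> (?D2 \<and> cycles_same_sign S (n - 1))" "int (upper_base S k) \<le> ?M - 3"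
      by blast
    then have "(int (upper_base S k) = ?M + 1 \<longleftrightarrow> ?D1) \<and>
        (int (upper_base S k) = ?M \<longleftrightarrow> ?D2 \<and> cycles_same_sign S (n - 1)) \<and>
        (int (upper_base S k) \<le> ?M - 3 \<or> ?M \<le> int (upper_base S k))"
    proof cases
      case 1
      then show ?thesis
        using T(2,3) by fastforce
    next
      case 2
      then show ?thesis
        using T(2,3) by fastforce
    next
      case 3
      then show ?thesis by fastforce
    qed
    then show "int (upper_base S k) = ?M + 1 \<longleftrightarrow> digraph_iso (with_proj (underlying S)) (with_proj (D1 n))"
      "int (upper_base S k) = ?M \<longleftrightarrow>
        digraph_iso (with_proj (underlying S)) (with_proj (D2 n)) \<and> cycles_same_sign S (n - 1)"
      "int (upper_base S k) \<le> ?M - 3 \<or> ?M \<le> int (upper_base S k)"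
      unfolding iso by blast+
  qed
  show ?thesis
    using main by fastforce
qed

end
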